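(* Let $g>0$ and let $N$ be a positive integer. The resolvent $W_1(x)$ of the Gaussian symplectic ensemble (see context) satisfies, for $x\in\mathbb{C}\setminus\mathbb{R}$, the fifth order linear inhomogeneous ordinary differential equation $$-\tfrac14\frac{g^4}{N^4}W_1^{(V)}+5\left[\tfrac14x^2-\frac gN\left(N+\tfrac14\right)\right]\frac{g^2}{N^2}W_1'''-\tfrac32\frac{g^2}{N^2}xW_1''$$ $$+\left[-x^4+(8N+2)\frac gNx^2+\left(-16N^2-8N+\tfrac12\right)\frac{g^2}{N^2}\right]W_1'+x\left[x^2-(4N+1)\frac gN\right]W_1=2N(x^2-4g)-5g,$$ subject to the boundary condition, for fixed $g,N$, $$W_1(x)\sim\frac{m_0}{x}+\frac{g\,m_2}{N x^3}+\frac{g^2m_4}{N^2x^5}+\frac{g^3m_6}{N^3x^7}+\cdots\qquad(x\to\infty),$$ where the moments $m_{2p}$ (the GSE moments of the context) are given by $m_0=N$, $2m_2=2N^2-N$, $4m_4=8N^3-10N^2+5N$, $8m_6=40N^4-88N^3+104N^2-41N$, $16m_8=224N^5-744N^4+1496N^3-1380N^2+509N$, $32m_{10}=1344N^6-6176N^5+18320N^4-28600N^3+24286N^2-8229N$, $64m_{12}=8448N^7-50752N^6+204768N^5-470080N^4+668592N^3-516958N^2+166377N$.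
   Context: Consider the probability law on $(\lambda_1,\dots,\lambda_N)\in\mathbb{R}^N$ with density proportional to $\prod_{l=1}^Ne^{-N\lambda_l^2/g}\prod_{1\le j<k\le N}|\lambda_k-\lambda_j|^4$ (the GSE, $\kappa=2$, with the scaling parameter $g$). The resolvent is $W_1(x)=\left\langle\sum_{j=1}^N\frac{1}{x-\lambda_j}\right\rangle$. The moments $m_{2p}=m_{2p}(N,2)$ are $\left\langle\sum_j\lambda_j^{2p}\right\rangle$ for the unscaled law with density proportional to $\prod_le^{-\lambda_l^2}\prod_{j<k}|\lambda_k-\lambda_j|^4$. The expansion as $x\to\infty$ is an asymptotic expansion (in closed sectors avoiding the real axis), not a convergent one. *)

theory Defs
  imports "HOL-Analysis.Analysis" "HOL-Library.Landau_Symbols"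
begin

text \<open>
  Points of \<open>N\<close>-dimensional real space are functions on the index set \<open>{..<N}\<close>, with Lebesgue
  measure the product of \<open>N\<close> copies of \<^const>\<open>lborel\<close>. The parameter \<open>c\<close> is the rate of the
  Gaussian factor: the scaled ensemble has \<open>c = N / g\<close>, the unscaled one \<open>c = 1\<close>.
\<close>

definition gse_weight :: "real \<Rightarrow> nat \<Rightarrow> (nat \<Rightarrow> real) \<Rightarrow> real" where
  "gse_weight c N l = (\<Prod>i<N. exp (- c * (l i)\<^sup>2)) * (\<Prod>k<N. \<Prod>j<k. \<bar>l k - l j\<bar> ^ 4)"

definition gse_partition :: "real \<Rightarrow> nat \<Rightarrow> real" where
  "gse_partition c N = (\<integral>l. gse_weight c N l \<partial>(PiM {..<N} (\<lambda>_. lborel)))"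

definition gse :: "real \<Rightarrow> nat \<Rightarrow> (nat \<Rightarrow> real) measure" where
  "gse c N = density (PiM {..<N} (\<lambda>_. lborel))
               (\<lambda>l. ennreal (gse_weight c N l / gse_partition c N))"

definition gse_resolvent :: "real \<Rightarrow> nat \<Rightarrow> complex \<Rightarrow> complex" where
  "gse_resolvent g N x =
     (\<integral>l. (\<Sum>j<N. 1 / (x - complex_of_real (l j))) \<partial>(gse (real N / g) N))"

definition gse_moment :: "nat \<Rightarrow> nat \<Rightarrow> real" where
  "gse_moment N k = (\<integral>l. (\<Sum>j<N. (l j) ^ k) \<partial>(gse 1 N))"

text \<open>
  For \<open>\<epsilon> > 0\<close> this is a pair of sectors, one in each open half-plane, closed up to the apex;
  \<open>0\<close> is not a member since \<open>Arg 0 = 0\<close>.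
\<close>

definition nonreal_sector :: "real \<Rightarrow> complex set" where
  "nonreal_sector \<epsilon> = {x. \<epsilon> \<le> \<bar>Arg x\<bar> \<and> \<bar>Arg x\<bar> \<le> pi - \<epsilon>}"

end

theory Submission
  imports Defs "HOL-Probability.Distributions" "HOL-Computational_Algebra.Polynomial" "HOL-Real_Asymp.Real_Asymp"
begin

text \<open>
  Singling out one eigenvalue \<open>t\<close>, its density is \<open>exp (- c t\<^sup>2)\<close> times the average, over the other
  \<open>N - 1\<close> eigenvalues, of \<open>P(t)\<^sup>4\<close>, where \<open>P\<close> is their characteristic polynomial. Let \<open>P\<^sub>j\<close> be
  \<open>P\<close> with the \<open>j\<close>-th factor removed. Integrating by parts along the vector fields with components
  \<open>P\<^sub>j\<^bsup>(a)\<^esup> P\<^bsup>(b1)\<^esup> P\<^bsup>(b2)\<^esup> P\<^bsup>(b3)\<^esup>\<close> gives linear relations between averages of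
  fourfold products of derivatives of \<open>P\<close>, because \<open>\<Sum>\<^sub>j P\<^sub>j\<^bsup>(a)\<^esup> P\<^sub>j\<^bsup>(b)\<^esup>\<close> is quadratic in the
  derivatives of \<open>P\<close> and \<open>\<Sum>\<^sub>j P\<^sub>j \<partial>\<^sub>j\<close> maps the weight \<open>\<Delta>\<^sup>4\<close> to \<open>2 P'' \<Delta>\<^sup>4\<close>. Thirteen of
  these relations combine to a homogeneous fifth order equation for the density. The Stieltjes transform carries
  it over to \<open>W\<^sub>1\<close>, the right-hand side coming from the first three moments, which are again computed by
  integration by parts. Tested against powers of \<open>t\<close>, the same equation is a recurrence for the moments.
\<close>

section \<open>Gaussian integrals and Stieltjes transforms in one variable\<close>


text \<open>Everything is kept inside polynomials. The exponent 4 is even, so the Vandermonde weight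
  is a polynomial on the whole space and integration by parts meets no boundary where eigenvalues
  coincide. Integrands are polynomials times a product Gaussian, so integrability and integration by
  parts reduce to monomials, whose integrals factor over the coordinates. The average over the other
  eigenvalues is taken coefficient by coefficient; the density is then a single polynomial
  \<open>q\<close> times a Gaussian, and \<open>t\<close>-derivatives act on \<open>q\<close> alone
  instead of being moved through a multiple integral. The resolvent equation is inhomogeneous
  although the density equation is not, because multiplication by \<open>t\<close> under the
  Stieltjes transform is multiplication by \<open>z\<close> only up to moments. The Gaussian rate
  \<open>c\<close> is a locale parameter because the theorem mixes two ensembles: the resolvent has
  rate \<open>N / g\<close>, the moments have rate 1.\<close>

lemma integral_derivative_eq_0:
  fixes F f :: "real \<Rightarrow> 'a::euclidean_space"
  assumes "\<And>x. (F has_vector_derivative f x) (at x)" "\<And>x. isCont f x" "integrable lborel f"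
    and "(F \<longlongrightarrow> 0) at_top" "(F \<longlongrightarrow> 0) at_bot"
  shows "integral\<^sup>L lborel f = 0"
proof -
  have "(LBINT x=-\<infinity>..\<infinity>. f x) = 0 - 0"
  proof (rule interval_integral_FTC_integrable)
    show "((F \<circ> real_of_ereal) \<longlongrightarrow> 0) (at_right (- \<infinity>))"
      "((F \<circ> real_of_ereal) \<longlongrightarrow> 0) (at_left \<infinity>)"
      using assms(4,5) by (simp_all add: ereal_tendsto_simps1)
  qed (use assms in \<open>auto simp: set_integrable_def\<close>)
  then show ?thesis
    by (simp add: interval_lebesgue_integral_def set_lebesgue_integral_def)
qed

lemma not_Reals_Im: "z \<notin> \<real> \<longleftrightarrow> Im z \<noteq> 0"
  by (simp add: complex_is_Real_iff)

lemma norm_ge_Im: "\<bar>Im z\<bar> \<le> norm (z - complex_of_real t)"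
  using abs_Im_le_cmod[of "z - complex_of_real t"] by simp

lemma norm_stieltjes_kernel_le:
  assumes "z \<notin> \<real>"
  shows "norm (1 / (z - complex_of_real t)) \<le> 1 / \<bar>Im z\<bar>"
  using norm_ge_Im[of z t] assms by (auto simp: norm_divide not_Reals_Im intro!: divide_left_mono mult_pos_pos)

lemma open_nonreal: "open (- \<real> :: complex set)"
  using closed_complex_Reals by (simp add: open_Compl)

locale gaussian_rate =
  fixes c :: real
  assumes c_pos: "c > 0"
begin

lemma tendsto_poly_gauss:
  "((\<lambda>t. poly q t * exp (- c * t\<^sup>2)) \<longlongrightarrow> 0) at_top"
  "((\<lambda>t. poly q t * exp (- c * t\<^sup>2)) \<longlongrightarrow> 0) at_bot"
proof -
  have *: "((\<lambda>t. poly q t * exp (- c * t\<^sup>2)) \<longlongrightarrow> 0) at_top" for q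
  proof -
    have 1: "((\<lambda>t. t ^ k * exp (- c * t\<^sup>2)) \<longlongrightarrow> 0) at_top" for k :: nat
      using c_pos by real_asymp
    have "((\<lambda>t. \<Sum>k\<le>degree q. coeff q k * (t ^ k * exp (- c * t\<^sup>2))) \<longlongrightarrow> (\<Sum>k\<le>degree q. coeff q k * 0)) at_top"
      by (intro tendsto_sum tendsto_mult tendsto_const 1)
    then show ?thesis
      by (simp add: poly_altdef sum_distrib_right mult.assoc)
  qed
  show "((\<lambda>t. poly q t * exp (- c * t\<^sup>2)) \<longlongrightarrow> 0) at_top" by (rule *)
  have "((\<lambda>t. poly (pcompose q [:0, -1:]) t * exp (- c * t\<^sup>2)) \<longlongrightarrow> 0) at_top" by (rule *)
  then show "((\<lambda>t. poly q t * exp (- c * t\<^sup>2)) \<longlongrightarrow> 0) at_bot"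
    by (simp add: filterlim_at_bot_mirror poly_pcompose)
qed

lemma integrable_power_gauss: "integrable lborel (\<lambda>t. t ^ k * exp (- c * t\<^sup>2))"
proof -
  have 1: "integrable lborel (\<lambda>x::real. exp (- x\<^sup>2) * x ^ k)"
  proof (cases "even k")
    case True
    then obtain m where "k = 2 * m" by blast
    then show ?thesis
      using has_bochner_integral_even_function[OF gaussian_moment_even_pos[where k=m]]
      by (auto simp: has_bochner_integral_iff)
  next
    case False
    then obtain m where "k = 2 * m + 1" by (auto elim: oddE)
    then show ?thesis
      using has_bochner_integral_odd_function[OF gaussian_moment_odd_pos[where k=m]]
      by (auto simp: has_bochner_integral_iff)
  qed
  have "integrable lborel (\<lambda>x. (1 / sqrt c) ^ k * (exp (- (0 + sqrt c * x)\<^sup>2) * (0 + sqrt c * x) ^ k))"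
    by (intro integrable_mult_right lborel_integrable_real_affine[OF 1]) (use c_pos in auto)
  then show ?thesis
    using c_pos by (simp add: power_mult_distrib field_simps)
qed

lemma integrable_poly_gauss: "integrable lborel (\<lambda>t. poly q t * exp (- c * t\<^sup>2))"
proof -
  have "integrable lborel (\<lambda>t. \<Sum>k\<le>degree q. coeff q k * (t ^ k * exp (- c * t\<^sup>2)))"
    by (intro Bochner_Integration.integrable_sum integrable_mult_right integrable_power_gauss)
  then show ?thesis
    by (simp add: poly_altdef sum_distrib_right mult.assoc)
qed

definition gint :: "real poly \<Rightarrow> real" where
  "gint q = (\<integral>t. poly q t * exp (- c * t\<^sup>2) \<partial>lborel)"

lemma gint_add: "gint (p + q) = gint p + gint q"
  unfolding gint_def poly_add distrib_right
  by (intro Bochner_Integration.integral_add integrable_poly_gauss)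

lemma gint_smult: "gint (smult a p) = a * gint p"
  unfolding gint_def by (simp add: mult.assoc)

lemma gint_0: "gint 0 = 0"
  unfolding gint_def by simp

lemma gint_diff: "gint (p - q) = gint p - gint q"
  using gint_add[of p "smult (-1) q"] by (simp add: gint_smult del: smult_minus_left) (simp add: gint_smult)

text \<open>The conjugate of \<open>d/dt\<close> by the Gaussian factor: differentiating a density
  becomes an operator on polynomials.\<close>

definition gderiv :: "real poly \<Rightarrow> real poly" where
  "gderiv q = pderiv q - [:0, 2 * c:] * q"

lemma gderiv_has_derivative:
  "((\<lambda>t. poly q t * exp (- c * t\<^sup>2)) has_real_derivative poly (gderiv q) t * exp (- c * t\<^sup>2)) (at t)"
  unfolding gderiv_def
  by (auto intro!: derivative_eq_intros simp: algebra_simps)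

lemma gint_gderiv: "gint (gderiv q) = 0"
  unfolding gint_def
proof (rule integral_derivative_eq_0)
  show "((\<lambda>t. poly q t * exp (- c * t\<^sup>2)) has_vector_derivative poly (gderiv q) t * exp (- c * t\<^sup>2)) (at t)" for t
    using gderiv_has_derivative by (simp add: has_real_derivative_iff_has_vector_derivative)
qed (use tendsto_poly_gauss integrable_poly_gauss in auto)

definition stieltjes :: "real poly \<Rightarrow> complex \<Rightarrow> complex" where
  "stieltjes q z = (\<integral>t. complex_of_real (poly q t * exp (- c * t\<^sup>2)) / (z - complex_of_real t) \<partial>lborel)"

lemma integrable_bounded_poly_gauss:
  fixes f :: "real \<Rightarrow> complex"
  assumes [measurable]: "f \<in> borel_measurable borel" and "\<And>t. norm (f t) \<le> b"
  shows "integrable lborel (\<lambda>t. f t * complex_of_real (poly q t * exp (- c * t\<^sup>2)))"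
proof (rule Bochner_Integration.integrable_bound)
  show "integrable lborel (\<lambda>t. b * (poly q t * exp (- c * t\<^sup>2)))"
    by (intro integrable_mult_right integrable_poly_gauss)
  have "b \<ge> 0" using assms(2)[of 0] norm_ge_zero order_trans by blast
  show "AE t in lborel. norm (f t * complex_of_real (poly q t * exp (- c * t\<^sup>2))) \<le> norm (b * (poly q t * exp (- c * t\<^sup>2)))"
    using \<open>b \<ge> 0\<close> assms(2) by (intro AE_I2) (simp add: norm_mult abs_mult mult_right_mono)
  have [measurable]: "poly q \<in> borel_measurable borel"
    by (intro borel_measurable_continuous_onI continuous_intros)
  show "(\<lambda>t. f t * complex_of_real (poly q t * exp (- c * t\<^sup>2))) \<in> borel_measurable lborel"
    by measurable
qed

lemma stieltjes_eq: "stieltjes q z = (\<integral>t. 1 / (z - complex_of_real t) * complex_of_real (poly q t * exp (- c * t\<^sup>2)) \<partial>lborel)"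
  unfolding stieltjes_def by (simp add: mult.commute)

lemma integrable_stieltjes:
  assumes "z \<notin> \<real>"
  shows "integrable lborel (\<lambda>t. 1 / (z - complex_of_real t) * complex_of_real (poly q t * exp (- c * t\<^sup>2)))"
  by (rule integrable_bounded_poly_gauss[OF _ norm_stieltjes_kernel_le[OF assms]]) measurable

lemma stieltjes_add: "z \<notin> \<real> \<Longrightarrow> stieltjes (p + q) z = stieltjes p z + stieltjes q z"
  unfolding stieltjes_eq poly_add distrib_right of_real_add distrib_left
  by (intro Bochner_Integration.integral_add integrable_stieltjes)

lemma stieltjes_smult: "stieltjes (smult a p) z = of_real a * stieltjes p z"
  unfolding stieltjes_def by (simp flip: integral_mult_right_zero add: mult.assoc)

lemma stieltjes_0: "stieltjes 0 z = 0"
  unfolding stieltjes_def by simp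

lemma stieltjes_diff: "z \<notin> \<real> \<Longrightarrow> stieltjes (p - q) z = stieltjes p z - stieltjes q z"
  using stieltjes_add[of z p "smult (-1) q"] unfolding stieltjes_smult by simp

text \<open>Integrated form of \<open>t / (z - t) = z / (z - t) - 1\<close>.\<close>

lemma stieltjes_pCons:
  assumes "z \<notin> \<real>"
  shows "stieltjes (pCons 0 q) z = z * stieltjes q z - of_real (gint q)"
proof -
  have nz: "z - complex_of_real t \<noteq> 0" for t
    using assms by auto
  have "z * stieltjes q z - of_real (gint q) =
    (\<integral>t. z * (1 / (z - complex_of_real t) * complex_of_real (poly q t * exp (- c * t\<^sup>2))) - complex_of_real (poly q t * exp (- c * t\<^sup>2)) \<partial>lborel)"
    unfolding gint_def stieltjes_eq integral_complex_of_real[symmetric]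
    unfolding integral_mult_right_zero[symmetric]
    by (intro Bochner_Integration.integral_diff[symmetric] integrable_mult_right integrable_stieltjes[OF assms]
        integrable_of_real integrable_poly_gauss)
  also have "\<dots> = stieltjes (pCons 0 q) z"
    unfolding stieltjes_eq
    by (intro Bochner_Integration.integral_cong refl) (use nz in \<open>simp add: divide_simps\<close>, simp add: algebra_simps)
  finally show ?thesis ..
qed

text \<open>The constant is the L1 norm of the density. The denominator later supplies the last
  power of \<open>1 / z\<close> in the remainder of the asymptotic expansion.\<close>

lemma stieltjes_bound: "\<exists>b. \<forall>z. z \<notin> \<real> \<longrightarrow> norm (stieltjes q z) \<le> b / \<bar>Im z\<bar>"
proof (intro exI allI impI)
  fix z :: complex assume z: "z \<notin> \<real>"
  have "norm (stieltjes q z) \<le> (\<integral>t. 1 / \<bar>Im z\<bar> * \<bar>poly q t * exp (- c * t\<^sup>2)\<bar> \<partial>lborel)"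
    unfolding stieltjes_eq
  proof (rule Bochner_Integration.integral_norm_bound_integral)
    show "norm (1 / (z - complex_of_real t) * complex_of_real (poly q t * exp (- c * t\<^sup>2)))
       \<le> 1 / \<bar>Im z\<bar> * \<bar>poly q t * exp (- c * t\<^sup>2)\<bar>" for t
      unfolding norm_mult norm_of_real by (intro mult_right_mono norm_stieltjes_kernel_le z) auto
  qed (intro integrable_stieltjes[OF z] integrable_mult_right integrable_abs integrable_poly_gauss)+
  also have "\<dots> = (\<integral>t. \<bar>poly q t * exp (- c * t\<^sup>2)\<bar> \<partial>lborel) / \<bar>Im z\<bar>"
    by (subst integral_mult_right_zero) simp
  finally show "norm (stieltjes q z) \<le> (\<integral>t. \<bar>poly q t * exp (- c * t\<^sup>2)\<bar> \<partial>lborel) / \<bar>Im z\<bar>" .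
qed

text \<open>On the kernel \<open>1 / (z - t)\<close> one has \<open>d/dz = - d/dt\<close>, so
  integration by parts in \<open>t\<close> moves the derivative onto the density. Differentiation
  under the integral is justified by an explicit quadratic error bound.\<close>

lemma has_field_derivative_stieltjes:
  assumes z: "z \<notin> \<real>"
  shows "(stieltjes q has_field_derivative stieltjes (gderiv q) z) (at z)"
proof -
  define e where "e t = complex_of_real (poly q t * exp (- c * t\<^sup>2))" for t
  \<comment> \<open>Half the distance to the real axis: the kernels at all \<open>w\<close> within
    distance \<open>d\<close> of \<open>z\<close> are bounded by \<open>1 / d\<close>.\<close>
  define d where "d = \<bar>Im z\<bar> / 2"
  have d: "d > 0" using z by (simp add: d_def not_Reals_Im)
  have bnd: "norm (1 / (w - complex_of_real t)) \<le> 1 / d" if "dist w z < d" for w t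
  proof -
    have "\<bar>Im w - Im z\<bar> < d"
      using that abs_Im_le_cmod[of "w - z"] by (simp add: dist_norm)
    then have "d \<le> \<bar>Im w\<bar>" unfolding d_def by linarith
    then show ?thesis
      using norm_stieltjes_kernel_le[of w t] d
      by (smt (verit) frac_le not_Reals_Im zero_le_one)
  qed
  have nonreal: "w \<notin> \<real>" if "dist w z < d" for w
  proof -
    have "\<bar>Im w - Im z\<bar> < d"
      using that abs_Im_le_cmod[of "w - z"] by (simp add: dist_norm)
    then show ?thesis using d by (auto simp: not_Reals_Im d_def)
  qed
  have int2: "integrable lborel (\<lambda>t. (1 / (z - complex_of_real t))\<^sup>2 * e t)"
    unfolding e_def
  proof (rule integrable_bounded_poly_gauss)
    show "norm ((1 / (z - complex_of_real t))\<^sup>2) \<le> (1 / d)\<^sup>2" for t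
      unfolding norm_power by (intro power_mono bnd) (use d in auto)
  qed measurable
  \<comment> \<open>\<open>- T\<close> is the derivative obtained by differentiating the kernel;
    \<open>key\<close> shows that the linear approximation with this slope has a quadratic
    error.\<close>
  define T where "T = (\<integral>t. (1 / (z - complex_of_real t))\<^sup>2 * e t \<partial>lborel)"
  define A where "A = (\<integral>t. (1 / d) ^ 3 * norm (e t) \<partial>lborel)"
  have inte: "integrable lborel (\<lambda>t. norm (e t))"
    unfolding e_def norm_of_real by (intro integrable_abs integrable_poly_gauss)
  have key: "norm (stieltjes q w - stieltjes q z + (w - z) * T) \<le> (norm (w - z))\<^sup>2 * A"
    if w: "dist w z < d" for w
  proof -
    have nz: "z - complex_of_real t \<noteq> 0" "w - complex_of_real t \<noteq> 0" for t
      using z nonreal[OF w] by auto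
    have id: "1 / (w - complex_of_real t) - 1 / (z - complex_of_real t) + (w - z) * (1 / (z - complex_of_real t))\<^sup>2 =
        (w - z)\<^sup>2 * ((1 / (z - complex_of_real t))\<^sup>2 * (1 / (w - complex_of_real t)))" for t
    proof -
      have "1 / (w - complex_of_real t) * (w - complex_of_real t) = 1" "1 / (z - complex_of_real t) * (z - complex_of_real t) = 1"
        using nz[of t] by auto
      then have "1 / (w - complex_of_real t) - 1 / (z - complex_of_real t) = (z - w) * (1 / (w - complex_of_real t)) * (1 / (z - complex_of_real t))"
        using nz[of t] by (simp add: divide_simps)
      \<comment> \<open>Here \<open>a\<close> and \<open>b\<close> stand for the kernels at
        \<open>w\<close> and \<open>z\<close>; the resolvent identity is applied twice.\<close>
      moreover have "a - b + (w - z) * b\<^sup>2 = (w - z)\<^sup>2 * (b\<^sup>2 * a)" if "a - b = (z - w) * a * b" for a b :: complex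
      proof -
        have ab: "(w - z) * a * b = b - a"
        proof -
          have "(w - z) * a * b = - ((z - w) * a * b)"
            by (simp add: algebra_simps)
          also have "\<dots> = b - a"
            unfolding that[symmetric] by simp
          finally show ?thesis .
        qed
        have "(w - z)\<^sup>2 * (b\<^sup>2 * a) = (w - z) * b * ((w - z) * a * b)"
          by (simp add: power2_eq_square)
        also have "\<dots> = (w - z) * b * (b - a)"
          by (simp only: ab)
        also have "\<dots> = (w - z) * b\<^sup>2 - (w - z) * a * b"
          by (simp add: algebra_simps power2_eq_square)
        finally show ?thesis unfolding ab by simp
      qed
      ultimately show ?thesis by blast
    qed
    have "stieltjes q w - stieltjes q z + (w - z) * T =
      (\<integral>t. (1 / (w - complex_of_real t) * e t - 1 / (z - complex_of_real t) * e t) + (w - z) * ((1 / (z - complex_of_real t))\<^sup>2 * e t) \<partial>lborel)"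
    proof -
      note i1 = integrable_stieltjes[OF nonreal[OF w], of q, folded e_def]
      note i2 = integrable_stieltjes[OF z, of q, folded e_def]
      show ?thesis
        unfolding Bochner_Integration.integral_add[OF Bochner_Integration.integrable_diff[OF i1 i2] integrable_mult_right[OF int2]]
          Bochner_Integration.integral_diff[OF i1 i2] integral_mult_right_zero
        unfolding stieltjes_eq T_def e_def ..
    qed
    also have "\<dots> = (\<integral>t. (w - z)\<^sup>2 * ((1 / (z - complex_of_real t))\<^sup>2 * (1 / (w - complex_of_real t))) * e t \<partial>lborel)"
      by (intro Bochner_Integration.integral_cong refl, subst id[symmetric]) (simp only: algebra_simps)
    finally have eq: "stieltjes q w - stieltjes q z + (w - z) * T = \<dots>" .
    have b2: "norm ((w - z)\<^sup>2 * ((1 / (z - complex_of_real t))\<^sup>2 * (1 / (w - complex_of_real t)))) \<le> (norm (w - z))\<^sup>2 * (1/d)^3" for t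
    proof -
      have "norm ((1 / (z - complex_of_real t))\<^sup>2 * (1 / (w - complex_of_real t))) \<le> (1/d)\<^sup>2 * (1/d)"
        unfolding norm_mult norm_power
        by (intro mult_mono power_mono bnd w norm_ge_zero zero_le_power divide_nonneg_nonneg) (use d in auto)
      then show ?thesis
        unfolding norm_mult[of "(w - z)\<^sup>2"] norm_power by (intro mult_left_mono) (auto simp: power3_eq_cube power2_eq_square)
    qed
    have "norm (stieltjes q w - stieltjes q z + (w - z) * T) \<le> (\<integral>t. (norm (w - z))\<^sup>2 * ((1 / d) ^ 3 * norm (e t)) \<partial>lborel)"
      unfolding eq
    proof (rule Bochner_Integration.integral_norm_bound_integral)
      show "integrable lborel (\<lambda>t. (w - z)\<^sup>2 * ((1 / (z - complex_of_real t))\<^sup>2 * (1 / (w - complex_of_real t))) * e t)"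
        unfolding e_def by (rule integrable_bounded_poly_gauss[OF _ b2]) measurable
      show "integrable lborel (\<lambda>t. (norm (w - z))\<^sup>2 * ((1 / d) ^ 3 * norm (e t)))"
        by (intro integrable_mult_right inte)
      show "norm ((w - z)\<^sup>2 * ((1 / (z - complex_of_real t))\<^sup>2 * (1 / (w - complex_of_real t))) * e t)
         \<le> (norm (w - z))\<^sup>2 * ((1 / d) ^ 3 * norm (e t))" for t
        unfolding norm_mult[of _ "e t"] mult.assoc[symmetric]
        by (intro mult_right_mono b2[unfolded mult.assoc[symmetric]] norm_ge_zero)
    qed
    also have "\<dots> = (norm (w - z))\<^sup>2 * A"
      unfolding A_def by (rule integral_mult_right_zero)
    finally show ?thesis .
  qed
  have A: "A \<ge> 0" unfolding A_def using d by (intro Bochner_Integration.integral_nonneg) auto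
  have "(stieltjes q has_field_derivative - T) (at z)"
    unfolding has_field_derivative_iff
  proof (rule LIM_zero_cancel, rule tendsto_0_le[where K=1])
    show "((\<lambda>w. norm (w - z) * A) \<longlongrightarrow> 0) (at z)"
      by (auto intro!: tendsto_eq_intros)
    have "eventually (\<lambda>w. dist w z < d \<and> w \<noteq> z) (at z)"
      using d by (auto simp: eventually_at intro!: exI[of _ d])
    then show "\<forall>\<^sub>F w in at z. norm ((stieltjes q w - stieltjes q z) / (w - z) - - T) \<le> norm (norm (w - z) * A) * 1"
    proof eventually_elim
      case (elim w)
      have "(stieltjes q w - stieltjes q z) / (w - z) - - T = (stieltjes q w - stieltjes q z + (w - z) * T) / (w - z)"
        using elim by (simp add: field_simps)
      then have "norm ((stieltjes q w - stieltjes q z) / (w - z) - - T) \<le> (norm (w - z))\<^sup>2 * A / norm (w - z)"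
        using key[of w] elim by (simp add: norm_divide divide_right_mono)
      also have "\<dots> = norm (w - z) * A"
        using elim by (simp add: power2_eq_square)
      finally show ?case using A by (simp add: abs_mult)
    qed
  qed
  moreover have "- T = stieltjes (gderiv q) z"
  proof -
    define e' where "e' t = complex_of_real (poly (gderiv q) t * exp (- c * t\<^sup>2))" for t
    have nz: "z - complex_of_real t \<noteq> 0" for t
      using z by auto
    \<comment> \<open>The integrand is the \<open>t\<close>-derivative of kernel times density,
      which tends to 0 at both ends.\<close>
    have "(\<integral>t. (1 / (z - complex_of_real t))\<^sup>2 * e t + 1 / (z - complex_of_real t) * e' t \<partial>lborel) = 0"
    proof (rule integral_derivative_eq_0)
      show "((\<lambda>t. 1 / (z - complex_of_real t) * e t) has_vector_derivative
          (1 / (z - complex_of_real t))\<^sup>2 * e t + 1 / (z - complex_of_real t) * e' t) (at t)" for t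
      proof -
        have 1: "(e has_vector_derivative e' t) (at t)"
          unfolding e_def[abs_def] e'_def by (intro has_vector_derivative_of_real gderiv_has_derivative)
        have 2: "((\<lambda>t. 1 / (z - complex_of_real t)) has_vector_derivative (1 / (z - complex_of_real t))\<^sup>2) (at t)"
        proof -
          have "((\<lambda>u. 1 / (z - u)) has_field_derivative (1 / (z - complex_of_real t))\<^sup>2) (at (complex_of_real t))"
            using nz[of t] by (auto intro!: derivative_eq_intros simp: power2_eq_square)
          from field_vector_diff_chain_at[OF has_vector_derivative_of_real[OF DERIV_ident] this]
          show ?thesis by (simp add: comp_def)
        qed
        from has_vector_derivative_mult[OF 2 1] show ?thesis by (simp add: add.commute)
      qed
      show "isCont (\<lambda>t. (1 / (z - complex_of_real t))\<^sup>2 * e t + 1 / (z - complex_of_real t) * e' t) t" for t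
        unfolding e_def e'_def using nz by (intro continuous_intros) auto
      show "integrable lborel (\<lambda>t. (1 / (z - complex_of_real t))\<^sup>2 * e t + 1 / (z - complex_of_real t) * e' t)"
        unfolding e'_def by (intro Bochner_Integration.integrable_add int2 integrable_stieltjes z)
      have *: "((\<lambda>t. 1 / (z - complex_of_real t) * e t) \<longlongrightarrow> 0) F"
        if "((\<lambda>t. poly q t * exp (- c * t\<^sup>2)) \<longlongrightarrow> 0) F" for F
      proof (rule tendsto_0_le[OF that, where K="1 / \<bar>Im z\<bar>"], rule always_eventually, rule allI)
        show "norm (1 / (z - complex_of_real t) * e t) \<le> norm (poly q t * exp (- c * t\<^sup>2)) * (1 / \<bar>Im z\<bar>)" for t
          unfolding norm_mult e_def norm_of_real real_norm_def abs_mult[symmetric] mult.commute[of _ "1 / \<bar>Im z\<bar>"]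
          by (intro mult_right_mono norm_stieltjes_kernel_le z) auto
      qed
      show "((\<lambda>t. 1 / (z - complex_of_real t) * e t) \<longlongrightarrow> 0) at_top" 
        "((\<lambda>t. 1 / (z - complex_of_real t) * e t) \<longlongrightarrow> 0) at_bot"
        by (intro * tendsto_poly_gauss)+
    qed
    then have "T + stieltjes (gderiv q) z = 0"
      unfolding T_def stieltjes_eq
      unfolding e'_def[symmetric]
      by (subst (asm) Bochner_Integration.integral_add[OF int2 integrable_stieltjes[OF z, of "gderiv q", folded e'_def]])
    then show ?thesis by (simp add: add_eq_0_iff)
  qed
  ultimately show ?thesis by simp
qed

text \<open>Iterated \<open>deriv\<close> depends on the values near the point, so the induction
  hypothesis is used on a whole neighbourhood off the real axis.\<close>

lemma higher_deriv_stieltjes: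
  assumes "z \<notin> \<real>"
  shows "(deriv ^^ k) (stieltjes q) z = stieltjes ((gderiv ^^ k) q) z"
  using assms
proof (induction k arbitrary: z)
  case (Suc k)
  have "eventually (\<lambda>w. w \<in> - \<real>) (nhds z)"
    using Suc.prems open_nonreal by (intro eventually_nhds_in_open) auto
  then have "eventually (\<lambda>w. (deriv ^^ k) (stieltjes q) w = stieltjes ((gderiv ^^ k) q) w) (nhds z)"
    by eventually_elim (use Suc.IH in auto)
  then have "deriv ((deriv ^^ k) (stieltjes q)) z = deriv (stieltjes ((gderiv ^^ k) q)) z"
    by (rule deriv_cong_ev) simp
  also have "\<dots> = stieltjes ((gderiv ^^ Suc k) q) z"
    using has_field_derivative_stieltjes[OF Suc.prems] by (simp add: DERIV_imp_deriv)
  finally show ?case by simp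
qed simp

text \<open>The geometric expansion of the kernel with exact remainder. The remainder is again a
  transform, so \<open>stieltjes_bound\<close> controls it.\<close>

lemma stieltjes_expansion:
  assumes "z \<notin> \<real>"
  shows "stieltjes q z = (\<Sum>k<n. of_real (gint (monom 1 k * q)) / z ^ (k + 1)) + stieltjes (monom 1 n * q) z / z ^ n"
proof (induction n)
  case 0
  then show ?case by (simp add: monom_0)
next
  case (Suc n)
  have z: "z \<noteq> 0" using assms by auto
  have *: "monom 1 (Suc n) * q = pCons 0 (monom 1 n * q)"
    by (simp add: monom_Suc)
  have "stieltjes (monom 1 (Suc n) * q) z = z * stieltjes (monom 1 n * q) z - of_real (gint (monom 1 n * q))"
    unfolding * by (rule stieltjes_pCons[OF assms])
  then have "stieltjes (monom 1 n * q) z / z ^ n =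
    of_real (gint (monom 1 n * q)) / z ^ (n + 1) + stieltjes (monom 1 (Suc n) * q) z / z ^ Suc n"
    using z by (simp add: field_simps)
  then show ?case using Suc by simp
qed

end

section \<open>Polynomial functions against a product Gaussian\<close>


text \<open>Generated by monomials and sums only, so that the induction rule reduces integral
  identities to a single monomial; closure under products is derived.\<close>

inductive polyfun :: "nat set \<Rightarrow> ((nat \<Rightarrow> real) \<Rightarrow> real) \<Rightarrow> bool" for I where
  polyfun_monom: "polyfun I (\<lambda>l. a * (\<Prod>i\<in>I. l i ^ k i))"
| polyfun_add: "polyfun I f \<Longrightarrow> polyfun I g \<Longrightarrow> polyfun I (\<lambda>l. f l + g l)"

lemma polyfun_const: "polyfun I (\<lambda>_. a)"
  using polyfun_monom[of I a "\<lambda>_. 0"] by simp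

lemma polyfun_coord:
  assumes "finite I" "i \<in> I"
  shows "polyfun I (\<lambda>l. l i)"
proof -
  have "(\<Prod>j\<in>I. l j ^ (if j = i then 1 else 0)) = l i" for l :: "nat \<Rightarrow> real"
    using assms by (subst prod.remove[of _ i]) auto
  then show ?thesis
    using polyfun_monom[of I 1 "\<lambda>j. if j = i then 1 else 0"] by simp
qed

lemma polyfun_mult:
  assumes "polyfun I f" "polyfun I g"
  shows "polyfun I (\<lambda>l. f l * g l)"
  using assms(1)
proof induction
  case (polyfun_monom a k)
  show ?case using assms(2)
  proof induction
    case (polyfun_monom b m)
    have "(\<lambda>l. a * (\<Prod>i\<in>I. l i ^ k i) * (b * (\<Prod>i\<in>I. l i ^ m i))) = (\<lambda>l. (a * b) * (\<Prod>i\<in>I. l i ^ (k i + m i)))"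
      by (simp add: fun_eq_iff power_add prod.distrib)
    then show ?case using polyfun.polyfun_monom[of I "a * b" "\<lambda>i. k i + m i"] by simp
  qed (simp add: distrib_left polyfun_add)
qed (simp add: distrib_right polyfun_add)

lemma polyfun_sum:
  assumes "\<And>j. j \<in> J \<Longrightarrow> polyfun I (f j)"
  shows "polyfun I (\<lambda>l. \<Sum>j\<in>J. f j l)"
  using assms
proof (induction J rule: infinite_finite_induct)
  case (insert j J)
  then show ?case using polyfun_add[of I "f j" "\<lambda>l. \<Sum>j\<in>J. f j l"] by simp
qed (simp_all add: polyfun_const)

lemma polyfun_prod:
  assumes "\<And>j. j \<in> J \<Longrightarrow> polyfun I (f j)"
  shows "polyfun I (\<lambda>l. \<Prod>j\<in>J. f j l)"
  using assms
proof (induction J rule: infinite_finite_induct)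
  case (insert j J)
  then show ?case using polyfun_mult[of I "f j" "\<lambda>l. \<Prod>j\<in>J. f j l"] by simp
qed (simp_all add: polyfun_const)

lemma polyfun_cmult: "polyfun I f \<Longrightarrow> polyfun I (\<lambda>l. a * f l)"
  using polyfun_mult[OF polyfun_const] .

lemma polyfun_diff: "polyfun I f \<Longrightarrow> polyfun I g \<Longrightarrow> polyfun I (\<lambda>l. f l - g l)"
  using polyfun_add[of I f "\<lambda>l. -1 * g l"] polyfun_cmult[of I g "-1"] by simp

lemma polyfun_minus: "polyfun I f \<Longrightarrow> polyfun I (\<lambda>l. - f l)"
  using polyfun_cmult[of I f "-1"] by simp

lemma polyfun_power: "polyfun I f \<Longrightarrow> polyfun I (\<lambda>l. f l ^ k)"
  using polyfun_prod[of "{..<k}" I "\<lambda>_. f"] by simp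

lemmas polyfun_intros = polyfun_const polyfun_coord polyfun_add polyfun_diff polyfun_minus polyfun_mult
  polyfun_power polyfun_sum polyfun_prod

context gaussian_rate
begin

definition gauss :: "nat set \<Rightarrow> (nat \<Rightarrow> real) \<Rightarrow> real" where
  "gauss I l = (\<Prod>i\<in>I. exp (- c * (l i)\<^sup>2))"

definition gmean :: "nat set \<Rightarrow> ((nat \<Rightarrow> real) \<Rightarrow> real) \<Rightarrow> real" where
  "gmean I f = (\<integral>l. f l * gauss I l \<partial>PiM I (\<lambda>_. lborel))"

lemma product_lborel: "product_sigma_finite (\<lambda>_::nat. lborel :: real measure)"
  by standard

lemma monom_gauss: "a * (\<Prod>i\<in>I. l i ^ k i) * gauss I l = a * (\<Prod>i\<in>I. l i ^ k i * exp (- c * (l i)\<^sup>2))"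
  by (simp add: gauss_def prod.distrib)

lemma integrable_polyfun:
  assumes "finite I" "polyfun I f"
  shows "integrable (PiM I (\<lambda>_. lborel)) (\<lambda>l. f l * gauss I l)"
  using assms(2)
proof induction
  case (polyfun_monom a k)
  show ?case
    unfolding monom_gauss
    by (intro integrable_mult_right product_sigma_finite.product_integrable_prod[OF product_lborel]
        assms(1) integrable_power_gauss)
qed (simp add: distrib_right)

lemma gmean_add:
  assumes "finite I" "polyfun I f" "polyfun I g"
  shows "gmean I (\<lambda>l. f l + g l) = gmean I f + gmean I g"
  unfolding gmean_def distrib_right
  by (intro Bochner_Integration.integral_add integrable_polyfun assms)

lemma gmean_cmult: "gmean I (\<lambda>l. a * f l) = a * gmean I f"
  unfolding gmean_def by (simp add: mult.assoc)

lemma gmean_sum: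
  assumes "finite I" "\<And>j. j \<in> J \<Longrightarrow> polyfun I (f j)"
  shows "gmean I (\<lambda>l. \<Sum>j\<in>J. f j l) = (\<Sum>j\<in>J. gmean I (f j))"
  using assms
proof (induction J rule: infinite_finite_induct)
  case (insert j J)
  then show ?case by (simp add: gmean_add polyfun_sum)
qed (simp_all add: gmean_def)

lemma gmean_monom:
  assumes "finite I"
  shows "gmean I (\<lambda>l. a * (\<Prod>i\<in>I. l i ^ k i)) = a * (\<Prod>i\<in>I. gint (monom 1 (k i)))"
proof -
  interpret product_sigma_finite "\<lambda>_::nat. lborel :: real measure" by (rule product_lborel)
  have "(\<integral>l. (\<Prod>i\<in>I. l i ^ k i * exp (- c * (l i)\<^sup>2)) \<partial>PiM I (\<lambda>_. lborel)) = (\<Prod>i\<in>I. gint (monom 1 (k i)))"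
    unfolding gint_def poly_monom mult_1
    by (intro product_integral_prod assms integrable_power_gauss)
  then show ?thesis
    unfolding gmean_def monom_gauss by simp
qed

text \<open>Integration by parts applied to \<open>t^k\<close>. For \<open>k = 0\<close> the
  truncated index \<open>k - 1\<close> comes with the factor 0.\<close>

lemma gint_monom_Suc: "2 * c * gint (monom 1 (Suc k)) = real k * gint (monom 1 (k - 1))"
proof -
  have "gderiv (monom 1 k) = smult (real k) (monom 1 (k - 1)) - smult (2 * c) (monom 1 (Suc k))"
    by (simp add: gderiv_def pderiv_monom monom_Suc smult_monom)
  then have "0 = real k * gint (monom 1 (k - 1)) - 2 * c * gint (monom 1 (Suc k))"
    using gint_gderiv[of "monom 1 k"] by (simp only: gint_diff gint_smult)
  then show ?thesis by simp
qed

text \<open>The induction builds the partial derivative together with the identity, hence the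
  existential; \<open>gauss_by_parts\<close> then identifies it by uniqueness of derivatives. For a
  monomial only the factor of coordinate \<open>j\<close> changes, and the claim is
  \<open>gint_monom_Suc\<close> for that factor.\<close>

lemma gauss_by_parts_ex:
  assumes I: "finite I" "j \<in> I" and f: "polyfun I f"
  shows "\<exists>f'. polyfun I f' \<and> (\<forall>l. ((\<lambda>t. f (l(j := t))) has_real_derivative f' l) (at (l j)))
    \<and> gmean I (\<lambda>l. f' l - 2 * c * l j * f l) = 0"
  using f
proof induction
  case (polyfun_monom a k)
  define J where "J = I - {j}"
  have IJ: "I = insert j J" "finite J" "j \<notin> J" using I by (auto simp: J_def)
  define f' where "f' l = a * real (k j) * (\<Prod>i\<in>I. l i ^ (k(j := k j - 1)) i)" for l :: "nat \<Rightarrow> real"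
  have eqJ: "(\<Prod>i\<in>J. l i ^ (k(j := m)) i) = (\<Prod>i\<in>J. l i ^ k i)" for l :: "nat \<Rightarrow> real" and m
    using IJ by (intro prod.cong) auto
  have eqJ': "(\<Prod>i\<in>J. (l(j := t)) i ^ k i) = (\<Prod>i\<in>J. l i ^ k i)" for l :: "nat \<Rightarrow> real" and t
    using IJ by (intro prod.cong) auto
  have eqJ'': "(\<Prod>i\<in>J. gint (monom 1 ((k(j := m)) i))) = (\<Prod>i\<in>J. gint (monom 1 (k i)))" for m
    using IJ by (intro prod.cong) auto
  have 1: "polyfun I f'"
    unfolding f'_def by (rule polyfun.polyfun_monom)
  have 2: "((\<lambda>t. a * (\<Prod>i\<in>I. (l(j := t)) i ^ k i)) has_real_derivative f' l) (at (l j))" for l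
  proof -
    have "((\<lambda>t. a * (t ^ k j * (\<Prod>i\<in>J. l i ^ k i))) has_real_derivative a * (real (k j) * l j ^ (k j - 1) * (\<Prod>i\<in>J. l i ^ k i))) (at (l j))"
      by (auto intro!: derivative_eq_intros)
    moreover have "a * (t ^ k j * (\<Prod>i\<in>J. l i ^ k i)) = a * (\<Prod>i\<in>I. (l(j := t)) i ^ k i)" for t
      unfolding IJ(1) prod.insert[OF IJ(2,3)] eqJ' by simp
    moreover have "a * (real (k j) * l j ^ (k j - 1) * (\<Prod>i\<in>J. l i ^ k i)) = f' l"
      unfolding f'_def IJ(1) prod.insert[OF IJ(2,3)] eqJ by simp
    ultimately show ?thesis by simp
  qed
  have "gmean I (\<lambda>l. f' l - 2 * c * l j * (a * (\<Prod>i\<in>I. l i ^ k i))) =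
      gmean I (\<lambda>l. a * real (k j) * (\<Prod>i\<in>I. l i ^ (k(j := k j - 1)) i) + (- 2 * c * a) * (\<Prod>i\<in>I. l i ^ (k(j := Suc (k j))) i))"
  proof (rule arg_cong[where f = "gmean I"], rule ext)
    fix l :: "nat \<Rightarrow> real"
    have "(\<Prod>i\<in>I. l i ^ (k(j := Suc (k j))) i) = l j * (\<Prod>i\<in>I. l i ^ k i)"
      unfolding IJ(1) prod.insert[OF IJ(2,3)] eqJ by simp
    then show "f' l - 2 * c * l j * (a * (\<Prod>i\<in>I. l i ^ k i)) =
      a * real (k j) * (\<Prod>i\<in>I. l i ^ (k(j := k j - 1)) i) + (- 2 * c * a) * (\<Prod>i\<in>I. l i ^ (k(j := Suc (k j))) i)"
      by (simp add: f'_def)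
  qed
  also have "\<dots> = a * (\<Prod>i\<in>J. gint (monom 1 (k i))) * (real (k j) * gint (monom 1 (k j - 1)) - 2 * c * gint (monom 1 (Suc (k j))))"
    unfolding gmean_add[OF I(1) polyfun.polyfun_monom polyfun.polyfun_monom] gmean_monom[OF I(1)]
    unfolding IJ(1) prod.insert[OF IJ(2,3)] eqJ'' by (simp add: algebra_simps)
  also have "\<dots> = 0"
    by (simp add: gint_monom_Suc)
  finally show ?case using 1 2 by blast
next
  case (polyfun_add f g)
  then obtain f' g' where *: "polyfun I f'" "polyfun I g'"
    "\<And>l. ((\<lambda>t. f (l(j := t))) has_real_derivative f' l) (at (l j))"
    "\<And>l. ((\<lambda>t. g (l(j := t))) has_real_derivative g' l) (at (l j))"
    "gmean I (\<lambda>l. f' l - 2 * c * l j * f l) = 0" "gmean I (\<lambda>l. g' l - 2 * c * l j * g l) = 0"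
    by blast
  have "gmean I (\<lambda>l. (f' l + g' l) - 2 * c * l j * (f l + g l)) =
    gmean I (\<lambda>l. (f' l - 2 * c * l j * f l) + (g' l - 2 * c * l j * g l))"
    by (simp add: algebra_simps)
  also have "\<dots> = 0"
    by (subst gmean_add) (use * polyfun_add.hyps I in \<open>auto intro!: polyfun_intros\<close>)
  finally show ?case
    using * by (intro exI[of _ "\<lambda>l. f' l + g' l"]) (auto intro!: polyfun.polyfun_add DERIV_add simp del: fun_upd_apply)
qed

lemma gauss_by_parts:
  assumes "finite I" "j \<in> I" "polyfun I f"
    and f': "\<And>l. ((\<lambda>t. f (l(j := t))) has_real_derivative f' l) (at (l j))"
  shows "polyfun I f'" "gmean I (\<lambda>l. f' l - 2 * c * l j * f l) = 0"
proof -
  obtain g where g: "polyfun I g" "\<And>l. ((\<lambda>t. f (l(j := t))) has_real_derivative g l) (at (l j))"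
    "gmean I (\<lambda>l. g l - 2 * c * l j * f l) = 0"
    using gauss_by_parts_ex[OF assms(1-3)] by blast
  have "g = f'"
    using DERIV_unique[OF g(2) f'] by auto
  with g show "polyfun I f'" "gmean I (\<lambda>l. f' l - 2 * c * l j * f l) = 0" by auto
qed

end

section \<open>The Vandermonde weight and the loop equations\<close>


definition charp :: "nat set \<Rightarrow> (nat \<Rightarrow> real) \<Rightarrow> real poly" where
  "charp I l = (\<Prod>i\<in>I. [:- l i, 1:])"

definition cder :: "nat set \<Rightarrow> nat \<Rightarrow> real \<Rightarrow> (nat \<Rightarrow> real) \<Rightarrow> real" where
  "cder I k t l = poly ((pderiv ^^ k) (charp I l)) t"

text \<open>The degree bound is uniform in \<open>l\<close>: it turns evaluation at \<open>t\<close>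
  into a fixed finite sum and allows averaging coefficient by coefficient.\<close>

definition polyfun_poly :: "nat set \<Rightarrow> ((nat \<Rightarrow> real) \<Rightarrow> real poly) \<Rightarrow> bool" where
  "polyfun_poly I R \<longleftrightarrow> (\<exists>d. \<forall>l. degree (R l) \<le> d) \<and> (\<forall>m. polyfun I (\<lambda>l. coeff (R l) m))"

lemma polyfun_poly_mult:
  assumes "polyfun_poly I R" "polyfun_poly I S"
  shows "polyfun_poly I (\<lambda>l. R l * S l)"
proof -
  obtain d e where "\<And>l. degree (R l) \<le> d" "\<And>l. degree (S l) \<le> e"
    using assms unfolding polyfun_poly_def by blast
  then have "degree (R l * S l) \<le> d + e" for l
    by (meson add_mono degree_mult_le order_trans)
  moreover have "polyfun I (\<lambda>l. coeff (R l * S l) m)" for m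
    using assms unfolding polyfun_poly_def coeff_mult
    by (intro polyfun_sum polyfun_mult) auto
  ultimately show ?thesis
    unfolding polyfun_poly_def by blast
qed

lemma polyfun_poly_const: "polyfun_poly I (\<lambda>_. q)"
  unfolding polyfun_poly_def by (auto intro: polyfun_const)

lemma polyfun_poly_power: "polyfun_poly I R \<Longrightarrow> polyfun_poly I (\<lambda>l. R l ^ k)"
  by (induction k) (simp_all add: polyfun_poly_const polyfun_poly_mult)

lemma polyfun_poly_prod:
  assumes "\<And>j. j \<in> J \<Longrightarrow> polyfun_poly I (R j)"
  shows "polyfun_poly I (\<lambda>l. \<Prod>j\<in>J. R j l)"
  using assms
  by (induction J rule: infinite_finite_induct) (simp_all add: polyfun_poly_const polyfun_poly_mult)

lemma polyfun_poly_pderiv: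
  assumes "polyfun_poly I R"
  shows "polyfun_poly I (\<lambda>l. pderiv (R l))"
proof -
  obtain d where "\<And>l. degree (R l) \<le> d"
    using assms unfolding polyfun_poly_def by blast
  then have "degree (pderiv (R l)) \<le> d" for l
    by (metis degree_pderiv diff_le_self order_trans)
  moreover have "polyfun I (\<lambda>l. coeff (pderiv (R l)) m)" for m
    using assms unfolding polyfun_poly_def coeff_pderiv
    by (intro polyfun_cmult) auto
  ultimately show ?thesis
    unfolding polyfun_poly_def by blast
qed

lemma polyfun_poly_higher_pderiv: "polyfun_poly I R \<Longrightarrow> polyfun_poly I (\<lambda>l. (pderiv ^^ k) (R l))"
  by (induction k) (auto intro: polyfun_poly_pderiv)

lemma polyfun_poly_charp:
  assumes "finite I" "J \<subseteq> I"
  shows "polyfun_poly I (charp J)"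
proof -
  have "polyfun_poly I (\<lambda>l. [:- l i, 1:])" if "i \<in> J" for i
  proof -
    have "i \<in> I" using that assms by auto
    have "polyfun I (\<lambda>l. coeff [:- l i, 1:] m)" for m
      by (cases m) (use \<open>i \<in> I\<close> assms in \<open>auto intro!: polyfun_minus polyfun_const polyfun_coord\<close>)
    then show ?thesis
      unfolding polyfun_poly_def by (intro conjI exI[of _ 1]) auto
  qed
  then show ?thesis
    unfolding charp_def[abs_def] by (rule polyfun_poly_prod)
qed

lemma polyfun_poly_eval:
  assumes "polyfun_poly I R"
  shows "polyfun I (\<lambda>l. poly (R l) t)"
proof -
  obtain d where d: "\<And>l. degree (R l) \<le> d"
    using assms unfolding polyfun_poly_def by blast
  have "poly (R l) t = (\<Sum>m\<le>d. coeff (R l) m * t ^ m)" for l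
    unfolding poly_altdef using d
    by (intro sum.mono_neutral_left) (auto simp: coeff_eq_0)
  then show ?thesis
    using assms unfolding polyfun_poly_def by (simp, intro polyfun_intros) auto
qed

lemma polyfun_cder: "finite I \<Longrightarrow> J \<subseteq> I \<Longrightarrow> polyfun I (cder J k t)"
  unfolding cder_def[abs_def]
  by (intro polyfun_poly_eval polyfun_poly_higher_pderiv polyfun_poly_charp)

lemma poly_charp: "poly (charp I l) t = (\<Prod>i\<in>I. t - l i)"
  by (simp add: charp_def poly_prod)

lemma charp_remove: "finite I \<Longrightarrow> j \<in> I \<Longrightarrow> charp I l = [:- l j, 1:] * charp (I - {j}) l"
  unfolding charp_def by (rule prod.remove)

text \<open>Leibniz' rule stops after two terms because one factor is linear; at
  \<open>k = 0\<close> the term with \<open>k - 1\<close> has coefficient 0.\<close>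

lemma higher_pderiv_linear_mult:
  "(pderiv ^^ k) ([:a, 1:] * q) = [:a, 1:] * (pderiv ^^ k) q + smult (of_nat k) ((pderiv ^^ (k - 1)) (q :: real poly))"
proof (induction k)
  case (Suc k)
  have 1: "pderiv [:a, 1:] = 1" by (simp add: pderiv_pCons one_pCons)
  have "(pderiv ^^ Suc k) ([:a, 1:] * q) =
     pderiv ([:a, 1:] * (pderiv ^^ k) q + smult (of_nat k) ((pderiv ^^ (k - 1)) q))"
    using Suc by simp
  also have "\<dots> = [:a, 1:] * (pderiv ^^ Suc k) q + (pderiv ^^ k) q + smult (of_nat k) (pderiv ((pderiv ^^ (k - 1)) q))"
    unfolding pderiv_add pderiv_mult pderiv_smult 1 by (simp add: algebra_simps)
  also have "smult (of_nat k) (pderiv ((pderiv ^^ (k - 1)) q)) = smult (of_nat k) ((pderiv ^^ k) q)"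
    by (cases k) auto
  finally show ?case
    by (simp add: smult_add_left)
qed simp

text \<open>The source of the algebraic relations between \<open>P\<close> and the
  \<open>P\<^sub>j\<close>. Since \<open>P\<^sub>j\<close> does not involve \<open>l j\<close>, it
  also exhibits each derivative of \<open>P\<close> as an affine function of
  \<open>l j\<close>.\<close>

lemma cder_remove:
  assumes "finite I" "j \<in> I"
  shows "cder I k t l = (t - l j) * cder (I - {j}) k t l + real k * cder (I - {j}) (k - 1) t l"
  unfolding cder_def charp_remove[OF assms] higher_pderiv_linear_mult by (simp add: algebra_simps)

lemma pderiv_charp: "finite I \<Longrightarrow> pderiv (charp I l) = (\<Sum>j\<in>I. charp (I - {j}) l)"
  unfolding charp_def pderiv_prod
  by (intro sum.cong refl) (simp add: pderiv_pCons one_pCons)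

lemma pderiv_sum: "pderiv (\<Sum>j\<in>I. f j) = (\<Sum>j\<in>I. pderiv (f j))"
  by (induction I rule: infinite_finite_induct) (simp_all add: pderiv_add)

lemma higher_pderiv_sum: "(pderiv ^^ k) (\<Sum>j\<in>I. f j) = (\<Sum>j\<in>I. (pderiv ^^ k) (f j))"
  by (induction k) (simp_all add: pderiv_sum)

lemma cder_Suc: "finite I \<Longrightarrow> cder I (Suc k) t l = (\<Sum>j\<in>I. cder (I - {j}) k t l)"
  unfolding cder_def funpow_Suc_right comp_def by (simp add: pderiv_charp higher_pderiv_sum poly_sum)

lemma charp_upd: "j \<notin> J \<Longrightarrow> charp J (l(j := t)) = charp J l"
  unfolding charp_def by (intro prod.cong) auto

lemma cder_upd: "j \<notin> J \<Longrightarrow> cder J k t (l(j := s)) = cder J k t l"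
  by (simp add: cder_def charp_upd)

lemma cder_coord_derivative:
  assumes "finite I" "j \<in> I"
  shows "((\<lambda>s. cder I k t (l(j := s))) has_real_derivative - cder (I - {j}) k t l) (at (l j))"
  unfolding cder_remove[OF assms] by (auto intro!: derivative_eq_intros simp: cder_upd)

definition vdm4 :: "nat set \<Rightarrow> (nat \<Rightarrow> real) \<Rightarrow> real" where
  "vdm4 I l = (\<Prod>k\<in>I. \<Prod>j\<in>{j\<in>I. j < k}. (l k - l j) ^ 4)"

text \<open>The even exponent makes the order within a pair irrelevant, so the factors involving
  \<open>j\<close> collect to the fourth power of \<open>P\<^sub>j\<close> evaluated at
  \<open>l j\<close>.\<close>

lemma vdm4_remove:
  assumes "finite I" "j \<in> I"
  shows "vdm4 I l = vdm4 (I - {j}) l * (cder (I - {j}) 0 (l j) l) ^ 4"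
proof -
  define J where "J = I - {j}"
  have J: "finite J" "j \<notin> J" "I = insert j J" using assms by (auto simp: J_def)
  have sw: "(l k - l j) ^ 4 = (l j - l k) ^ 4" for k
    using power_minus_even[of 4 "l k - l j"] by simp
  have 1: "(\<Prod>i\<in>{i\<in>I. i < j}. (l j - l i) ^ 4) = (\<Prod>i\<in>J. if i < j then (l j - l i) ^ 4 else 1)"
  proof -
    have "{i\<in>I. i < j} = {i\<in>J. i < j}" using J by auto
    then show ?thesis using J by (simp add: prod.inter_filter)
  qed
  have 2: "(\<Prod>i\<in>{i\<in>I. i < k}. (l k - l i) ^ 4) = (if j < k then (l j - l k) ^ 4 else 1) * (\<Prod>i\<in>{i\<in>J. i < k}. (l k - l i) ^ 4)"
    if "k \<in> J" for k
  proof (cases "j < k")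
    case True
    then have "{i\<in>I. i < k} = insert j {i\<in>J. i < k}" using J by auto
    then show ?thesis using True J sw by simp
  next
    case False
    then have "{i\<in>I. i < k} = {i\<in>J. i < k}" using J by auto
    then show ?thesis using False by simp
  qed
  have "vdm4 I l = (\<Prod>i\<in>{i\<in>I. i < j}. (l j - l i) ^ 4) * (\<Prod>k\<in>J. \<Prod>i\<in>{i\<in>I. i < k}. (l k - l i) ^ 4)"
    unfolding vdm4_def by (subst (1) J(3)) (use J in simp)
  also have "\<dots> = (\<Prod>i\<in>J. if i < j then (l j - l i) ^ 4 else 1) * ((\<Prod>k\<in>J. if j < k then (l j - l k) ^ 4 else 1) * vdm4 J l)"
    unfolding 1 vdm4_def prod.distrib[symmetric] using 2 by simp
  also have "\<dots> = (\<Prod>i\<in>J. (if i < j then (l j - l i) ^ 4 else 1) * (if j < i then (l j - l i) ^ 4 else 1)) * vdm4 J l"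
    by (simp add: prod.distrib)
  also have "(\<Prod>i\<in>J. (if i < j then (l j - l i) ^ 4 else 1) * (if j < i then (l j - l i) ^ 4 else 1)) = (\<Prod>i\<in>J. (l j - l i) ^ 4)"
  proof (rule prod.cong[OF refl])
    fix i assume "i \<in> J"
    then have "i < j \<or> j < i" using J by (metis nat_neq_iff)
    then show "(if i < j then (l j - l i) ^ 4 else 1) * (if j < i then (l j - l i) ^ 4 else 1) = (l j - l i) ^ 4"
      by auto
  qed
  finally show ?thesis
    by (simp add: cder_def poly_charp J_def prod_power_distrib)
qed

text \<open>The partial derivative of the weight in coordinate \<open>j\<close>, read off from
  \<open>vdm4_remove\<close>. This form has no denominators and makes sense where coordinates
  coincide.\<close>

definition vdm4_deriv :: "nat set \<Rightarrow> nat \<Rightarrow> (nat \<Rightarrow> real) \<Rightarrow> real" where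
  "vdm4_deriv I j l = vdm4 (I - {j}) l * (4 * cder (I - {j}) 0 (l j) l ^ 3 * cder (I - {j}) 1 (l j) l)"

lemma vdm4_upd: "j \<notin> J \<Longrightarrow> vdm4 J (l(j := t)) = vdm4 J l"
  unfolding vdm4_def by (intro prod.cong refl) auto

lemma vdm4_coord_derivative:
  assumes "finite I" "j \<in> I"
  shows "((\<lambda>s. vdm4 I (l(j := s))) has_real_derivative vdm4_deriv I j l) (at (l j))"
proof -
  have "((\<lambda>s. vdm4 (I - {j}) l * poly (charp (I - {j}) l) s ^ 4) has_real_derivative vdm4_deriv I j l) (at (l j))"
    unfolding vdm4_deriv_def cder_def
    by (auto intro!: derivative_eq_intros simp: eval_nat_numeral)
  then show ?thesis
    unfolding vdm4_remove[OF assms] by (simp add: vdm4_upd cder_upd) (simp add: cder_def)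
qed

lemma vdm4_eq_0:
  assumes "finite I" "a \<in> I" "b \<in> I" "a \<noteq> b" "l a = l b"
  shows "vdm4 I l = 0"
  unfolding vdm4_remove[OF assms(1,2)] cder_def poly_charp funpow_0
  using assms by (auto simp: prod_zero_iff)

text \<open>If the coordinates are distinct, \<open>\<partial>\<^sub>j \<Delta>\<^sup>4 = \<Delta>\<^sup>4 (\<Sum>i. 4 / (l j - l i))\<close>, and exchanging
  \<open>i\<close> and \<open>j\<close> symmetrises the double sum; its diagonal is \<open>1 / 0 = 0\<close>. If two coordinates
  coincide, both sides vanish.\<close>
lemma sum_vdm4_deriv:
  assumes I: "finite I"
    and h: "\<And>i j. i \<in> I \<Longrightarrow> j \<in> I \<Longrightarrow> i \<noteq> j \<Longrightarrow> f j - f i = (l j - l i) * h i j"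
  shows "(\<Sum>j\<in>I. f j * vdm4_deriv I j l) = 2 * (\<Sum>j\<in>I. \<Sum>i\<in>I - {j}. h i j) * vdm4 I l"
proof (cases "inj_on l I")
  case True
  have d: "vdm4_deriv I j l = vdm4 I l * (4 * (\<Sum>i\<in>I. 1 / (l j - l i)))" if j: "j \<in> I" for j
  proof -
    define J where "J = I - {j}"
    have J: "finite J" using I by (simp add: J_def)
    have nz: "l j - l i \<noteq> 0" if "i \<in> J" for i
      using True j that by (auto simp: J_def inj_on_def)
    have "cder J 1 (l j) l = (\<Sum>i\<in>J. cder (J - {i}) 0 (l j) l)"
      using cder_Suc[OF J, of 0] by simp
    also have "\<dots> = (\<Sum>i\<in>J. cder J 0 (l j) l * (1 / (l j - l i)))"
    proof (rule sum.cong[OF refl])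
      fix i assume i: "i \<in> J"
      show "cder (J - {i}) 0 (l j) l = cder J 0 (l j) l * (1 / (l j - l i))"
        using cder_remove[OF J i, of 0 "l j" l] nz[OF i] by (simp add: field_simps)
    qed
    also have "\<dots> = cder J 0 (l j) l * (\<Sum>i\<in>J. 1 / (l j - l i))"
      by (simp add: sum_distrib_left)
    also have "(\<Sum>i\<in>J. 1 / (l j - l i)) = (\<Sum>i\<in>I. 1 / (l j - l i))"
      using sum.remove[OF I j, of "\<lambda>i. 1 / (l j - l i)"] by (simp add: J_def)
    finally have "cder J 1 (l j) l = cder J 0 (l j) l * (\<Sum>i\<in>I. 1 / (l j - l i))" .
    then show ?thesis
      unfolding vdm4_remove[OF I j] vdm4_deriv_def J_def[symmetric]
      by (simp add: eval_nat_numeral)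
  qed
  define S where "S = (\<Sum>j\<in>I. \<Sum>i\<in>I. f j / (l j - l i))"
  have "S = (\<Sum>j\<in>I. \<Sum>i\<in>I. f i / (l i - l j))"
    unfolding S_def by (rule sum.swap)
  then have "2 * S = (\<Sum>j\<in>I. \<Sum>i\<in>I. f j / (l j - l i) + f i / (l i - l j))"
    unfolding sum.distrib S_def by simp
  also have "\<dots> = (\<Sum>j\<in>I. \<Sum>i\<in>I - {j}. h i j)"
  proof (rule sum.cong[OF refl])
    fix j assume j: "j \<in> I"
    have "(\<Sum>i\<in>I. f j / (l j - l i) + f i / (l i - l j)) = (\<Sum>i\<in>I - {j}. f j / (l j - l i) + f i / (l i - l j))"
      using sum.remove[OF I j, of "\<lambda>i. f j / (l j - l i) + f i / (l i - l j)"] by simp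
    also have "\<dots> = (\<Sum>i\<in>I - {j}. h i j)"
    proof (rule sum.cong[OF refl])
      fix i assume i: "i \<in> I - {j}"
      have nz: "l j - l i \<noteq> 0" using True i j by (auto simp: inj_on_def)
      have "f j / (l j - l i) + f i / (l i - l j) = (f j - f i) / (l j - l i)"
        using nz minus_divide_right[of "f i" "l j - l i"] by (simp add: diff_divide_distrib)
      also have "\<dots> = h i j"
        using h[of i j] i j nz by simp
      finally show "f j / (l j - l i) + f i / (l i - l j) = h i j" .
    qed
    finally show "(\<Sum>i\<in>I. f j / (l j - l i) + f i / (l i - l j)) = (\<Sum>i\<in>I - {j}. h i j)" .
  qed
  finally have S: "2 * S = (\<Sum>j\<in>I. \<Sum>i\<in>I - {j}. h i j)" .
  have "(\<Sum>j\<in>I. f j * vdm4_deriv I j l) = (\<Sum>j\<in>I. f j * (vdm4 I l * (4 * (\<Sum>i\<in>I. 1 / (l j - l i)))))"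
    by (intro sum.cong refl) (simp add: d)
  also have "\<dots> = 4 * vdm4 I l * S"
    unfolding S_def by (simp add: sum_distrib_left mult_ac)
  finally show ?thesis using S by (simp flip: S)
next
  case False
  then obtain a b where ab: "a \<in> I" "b \<in> I" "a \<noteq> b" "l a = l b"
    by (auto simp: inj_on_def)
  have "vdm4_deriv I j l = 0" if j: "j \<in> I" for j
  proof (cases "j = a \<or> j = b")
    case True
    then have "cder (I - {j}) 0 (l j) l = 0"
      unfolding cder_def poly_charp funpow_0 using ab I by (auto simp: prod_zero_iff intro: bexI[of _ a] bexI[of _ b])
    then show ?thesis by (simp add: vdm4_deriv_def)
  next
    case False
    then have "vdm4 (I - {j}) l = 0"
      using I ab by (intro vdm4_eq_0[of _ a b]) auto
    then show ?thesis by (simp add: vdm4_deriv_def)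
  qed
  then show ?thesis using vdm4_eq_0[OF I ab] by simp
qed

lemma polyfun_vdm4: "finite I \<Longrightarrow> polyfun I (vdm4 I)"
  unfolding vdm4_def[abs_def] by (intro polyfun_intros) auto

text \<open>By \<open>cder_remove\<close>, the divided difference of the components for
  \<open>i\<close> and \<open>j\<close> is the derivative of \<open>P\<close> with both factors
  removed; summing over ordered pairs of distinct indices raises the order by two.\<close>

lemma sum_cder_vdm4_deriv:
  assumes I: "finite I"
  shows "(\<Sum>j\<in>I. cder (I - {j}) a t l * vdm4_deriv I j l) = 2 * cder I (a + 2) t l * vdm4 I l"
proof -
  have "(\<Sum>j\<in>I. cder (I - {j}) a t l * vdm4_deriv I j l) =
     2 * (\<Sum>j\<in>I. \<Sum>i\<in>I - {j}. cder (I - {j} - {i}) a t l) * vdm4 I l"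
  proof (rule sum_vdm4_deriv[OF I])
    fix i j assume ij: "i \<in> I" "j \<in> I" "i \<noteq> j"
    have *: "I - {i} - {j} = I - {j} - {i}" by auto
    show "cder (I - {j}) a t l - cder (I - {i}) a t l = (l j - l i) * cder (I - {j} - {i}) a t l"
      using cder_remove[of "I - {j}" i a t l] cder_remove[of "I - {i}" j a t l] ij I
      unfolding * by (simp add: algebra_simps)
  qed
  also have "(\<Sum>j\<in>I. \<Sum>i\<in>I - {j}. cder (I - {j} - {i}) a t l) = cder I (a + 2) t l"
    using I by (simp add: cder_Suc)
  finally show ?thesis .
qed

definition cder_prod :: "nat set \<Rightarrow> nat \<Rightarrow> nat \<Rightarrow> real \<Rightarrow> (nat \<Rightarrow> real) \<Rightarrow> real" where
  "cder_prod I a b t l = (\<Sum>j\<in>I. cder (I - {j}) a t l * cder (I - {j}) b t l)"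

lemma cder_prod_commute: "cder_prod I a b t l = cder_prod I b a t l"
  by (simp add: cder_prod_def mult.commute)

text \<open>Each raised derivative is a sum over removed factors. Inserting
  \<open>cder_remove\<close> for the unremoved ones, the terms with \<open>t - l j\<close> cancel.
  At \<open>a = 0\<close> the relation gives \<open>cder_prod I 0 (b - 1)\<close> outright; the
  other orders follow recursively.\<close>

lemma cder_prod_rec:
  assumes I: "finite I"
  shows "real b * cder_prod I a (b - 1) t l - real a * cder_prod I (a - 1) b t l
    = cder I (Suc a) t l * cder I b t l - cder I a t l * cder I (Suc b) t l"
proof -
  have "cder I (Suc a) t l * cder I b t l - cder I a t l * cder I (Suc b) t l =
    (\<Sum>j\<in>I. cder (I - {j}) a t l * cder I b t l - cder I a t l * cder (I - {j}) b t l)"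
    by (simp add: cder_Suc[OF I] sum_distrib_left sum_distrib_right sum_subtractf)
  also have "\<dots> = (\<Sum>j\<in>I. real b * (cder (I - {j}) a t l * cder (I - {j}) (b - 1) t l)
      - real a * (cder (I - {j}) (a - 1) t l * cder (I - {j}) b t l))"
    by (intro sum.cong refl) (simp add: cder_remove[OF I] algebra_simps)
  finally show ?thesis
    by (simp add: cder_prod_def sum_subtractf sum_distrib_left)
qed

text \<open>This is \<open>cder_remove\<close> solved for \<open>l j * cder (I - {j}) a t l\<close>
  and summed over \<open>j\<close>.\<close>

lemma cder_coord_sum:
  assumes I: "finite I"
  shows "(\<Sum>j\<in>I. l j * cder (I - {j}) a t l) = t * cder I (a + 1) t l + (real a - real (card I)) * cder I a t l"
proof -
  have "(\<Sum>j\<in>I. l j * cder (I - {j}) a t l) =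
    (\<Sum>j\<in>I. t * cder (I - {j}) a t l + real a * cder (I - {j}) (a - 1) t l - cder I a t l)"
    by (intro sum.cong refl) (simp add: cder_remove[OF I] algebra_simps)
  also have "\<dots> = t * cder I (a + 1) t l + real a * (\<Sum>j\<in>I. cder (I - {j}) (a - 1) t l) - real (card I) * cder I a t l"
    by (simp add: cder_Suc[OF I] sum.distrib sum_subtractf sum_distrib_left)
  also have "real a * (\<Sum>j\<in>I. cder (I - {j}) (a - 1) t l) = real a * cder I a t l"
    by (cases a) (simp_all add: cder_Suc[OF I])
  finally show ?thesis by (simp add: algebra_simps)
qed

context gaussian_rate
begin

definition vmean :: "nat set \<Rightarrow> ((nat \<Rightarrow> real) \<Rightarrow> real) \<Rightarrow> real" where
  "vmean I f = gmean I (\<lambda>l. vdm4 I l * f l)"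

text \<open>The divergence theorem for the vector field \<open>f\<close> against the full weight:
  \<open>g\<close> is the logarithmic derivative of the Vandermonde part along \<open>f\<close>, and
  the last sum is that of the Gaussian part.\<close>

lemma vmean_by_parts:
  assumes I: "finite I"
    and f: "\<And>j. j \<in> I \<Longrightarrow> polyfun I (f j)"
    and f': "\<And>j l. j \<in> I \<Longrightarrow> ((\<lambda>t. f j (l(j := t))) has_real_derivative f' j l) (at (l j))"
    and g: "\<And>l. (\<Sum>j\<in>I. f j l * vdm4_deriv I j l) = g l * vdm4 I l"
  shows "vmean I (\<lambda>l. (\<Sum>j\<in>I. f' j l) + g l - 2 * c * (\<Sum>j\<in>I. l j * f j l)) = 0"
proof -
  have der: "((\<lambda>t. vdm4 I (l(j := t)) * f j (l(j := t))) has_real_derivative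
      vdm4_deriv I j l * f j l + f' j l * vdm4 I l) (at (l j))" if "j \<in> I" for j l
    using DERIV_mult[OF vdm4_coord_derivative[OF I that, of l] f'[OF that, of l]] by simp
  have pf: "polyfun I (\<lambda>l. vdm4 I l * f j l)" if "j \<in> I" for j
    using that f I by (intro polyfun_mult polyfun_vdm4) auto
  note bp = gauss_by_parts[OF I _ pf der]
  have "vmean I (\<lambda>l. (\<Sum>j\<in>I. f' j l) + g l - 2 * c * (\<Sum>j\<in>I. l j * f j l)) =
    gmean I (\<lambda>l. \<Sum>j\<in>I. (vdm4_deriv I j l * f j l + f' j l * vdm4 I l) - 2 * c * l j * (vdm4 I l * f j l))"
    unfolding vmean_def
  proof (rule arg_cong[where f = "gmean I"], rule ext)
    fix l
    have "(\<Sum>j\<in>I. (vdm4_deriv I j l * f j l + f' j l * vdm4 I l) - 2 * c * l j * (vdm4 I l * f j l)) =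
      (\<Sum>j\<in>I. f j l * vdm4_deriv I j l) + (\<Sum>j\<in>I. f' j l) * vdm4 I l - 2 * c * (\<Sum>j\<in>I. l j * f j l) * vdm4 I l"
      by (simp add: sum.distrib sum_subtractf sum_distrib_left sum_distrib_right mult_ac)
    then show "vdm4 I l * ((\<Sum>j\<in>I. f' j l) + g l - 2 * c * (\<Sum>j\<in>I. l j * f j l)) =
      (\<Sum>j\<in>I. (vdm4_deriv I j l * f j l + f' j l * vdm4 I l) - 2 * c * l j * (vdm4 I l * f j l))"
      unfolding g by (simp add: algebra_simps)
  qed
  also have "\<dots> = (\<Sum>j\<in>I. gmean I (\<lambda>l. (vdm4_deriv I j l * f j l + f' j l * vdm4 I l) - 2 * c * l j * (vdm4 I l * f j l)))"
  proof (rule gmean_sum[OF I])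
    fix j assume j: "j \<in> I"
    show "polyfun I (\<lambda>l. (vdm4_deriv I j l * f j l + f' j l * vdm4 I l) - 2 * c * l j * (vdm4 I l * f j l))"
      by (rule polyfun_diff[OF bp(1)[OF j j j] polyfun_mult[OF polyfun_cmult[OF polyfun_coord[OF I j]] pf[OF j]]])
  qed
  also have "\<dots> = 0"
    using bp(2) by (intro sum.neutral) blast
  finally show ?thesis .
qed

text \<open>The leading factor of the \<open>j\<close>-th component is free of \<open>l j\<close>,
  so the derivative falls on the other three factors. Each of them turns into minus its version with
  factor \<open>j\<close> removed, whence the three \<open>cder_prod\<close> terms.\<close>

lemma loop_equation:
  assumes I: "finite I"
  shows "vmean I (\<lambda>l. 2 * cder I (a + 2) t l * (cder I b1 t l * cder I b2 t l * cder I b3 t l)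
    - (cder_prod I a b1 t l * cder I b2 t l * cder I b3 t l
      + cder_prod I a b2 t l * cder I b1 t l * cder I b3 t l
      + cder_prod I a b3 t l * cder I b1 t l * cder I b2 t l)
    - 2 * c * (t * cder I (a + 1) t l + (real a - real (card I)) * cder I a t l) * (cder I b1 t l * cder I b2 t l * cder I b3 t l)) = 0"
proof -
  define f where "f j l = cder (I - {j}) a t l * (cder I b1 t l * cder I b2 t l * cder I b3 t l)" for j l
  define f' where "f' j l = - cder (I - {j}) a t l * (cder (I - {j}) b1 t l * cder I b2 t l * cder I b3 t l
     + cder (I - {j}) b2 t l * cder I b1 t l * cder I b3 t l
     + cder (I - {j}) b3 t l * cder I b1 t l * cder I b2 t l)" for j l
  define g where "g l = 2 * cder I (a + 2) t l * (cder I b1 t l * cder I b2 t l * cder I b3 t l)" for l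
  have "vmean I (\<lambda>l. (\<Sum>j\<in>I. f' j l) + g l - 2 * c * (\<Sum>j\<in>I. l j * f j l)) = 0"
  proof (rule vmean_by_parts[OF I])
    show "polyfun I (f j)" for j
      unfolding f_def[abs_def] using I by (intro polyfun_mult polyfun_cder) auto
    show "((\<lambda>s. f j (l(j := s))) has_real_derivative f' j l) (at (l j))" if j: "j \<in> I" for j l
    proof -
      have "((\<lambda>s. cder (I - {j}) a t l * (cder I b1 t (l(j := s)) * cder I b2 t (l(j := s)) * cder I b3 t (l(j := s))))
        has_real_derivative f' j l) (at (l j))"
        unfolding f'_def
        by (rule derivative_eq_intros cder_coord_derivative[OF I j] refl)+
           (simp add: algebra_simps)
      then show ?thesis by (simp add: f_def cder_upd)
    qed
    show "(\<Sum>j\<in>I. f j l * vdm4_deriv I j l) = g l * vdm4 I l" for l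
    proof -
      have "(\<Sum>j\<in>I. f j l * vdm4_deriv I j l) =
        (cder I b1 t l * cder I b2 t l * cder I b3 t l) * (\<Sum>j\<in>I. cder (I - {j}) a t l * vdm4_deriv I j l)"
        unfolding f_def sum_distrib_left by (simp add: mult_ac)
      then show ?thesis
        unfolding sum_cder_vdm4_deriv[OF I] g_def by simp
    qed
  qed
  moreover have "(\<Sum>j\<in>I. f' j l) + g l - 2 * c * (\<Sum>j\<in>I. l j * f j l) =
    2 * cder I (a + 2) t l * (cder I b1 t l * cder I b2 t l * cder I b3 t l)
    - (cder_prod I a b1 t l * cder I b2 t l * cder I b3 t l
      + cder_prod I a b2 t l * cder I b1 t l * cder I b3 t l
      + cder_prod I a b3 t l * cder I b1 t l * cder I b2 t l)
    - 2 * c * (t * cder I (a + 1) t l + (real a - real (card I)) * cder I a t l) * (cder I b1 t l * cder I b2 t l * cder I b3 t l)" for l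
  proof -
    have "(\<Sum>j\<in>I. l j * f j l) = (\<Sum>j\<in>I. l j * cder (I - {j}) a t l) * (cder I b1 t l * cder I b2 t l * cder I b3 t l)"
      unfolding f_def sum_distrib_right by (simp add: mult_ac)
    moreover have "(\<Sum>j\<in>I. f' j l) = - (cder_prod I a b1 t l * cder I b2 t l * cder I b3 t l
      + cder_prod I a b2 t l * cder I b1 t l * cder I b3 t l
      + cder_prod I a b3 t l * cder I b1 t l * cder I b2 t l)"
      unfolding f'_def cder_prod_def sum_distrib_right
      by (simp add: sum_negf[symmetric] sum.distrib[symmetric] algebra_simps)
    ultimately show ?thesis
      unfolding g_def cder_coord_sum[OF I] by simp
  qed
  ultimately show ?thesis by simp
qed

end

section \<open>The differential equation for the one-point density\<close>


lemma pderiv_numeral [simp]: "pderiv (numeral k :: real poly) = 0"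
  using pderiv_of_nat[of "numeral k"] by simp

lemma poly_higher_pderiv_power4:
  fixes p :: "real poly" and t :: real
  defines "p0 \<equiv> poly p t" and "p1 \<equiv> poly (pderiv p) t" and "p2 \<equiv> poly ((pderiv ^^ 2) p) t"
    and "p3 \<equiv> poly ((pderiv ^^ 3) p) t" and "p4 \<equiv> poly ((pderiv ^^ 4) p) t" and "p5 \<equiv> poly ((pderiv ^^ 5) p) t"
  shows "poly (pderiv (p ^ 4)) t = 4 * p0 ^ 3 * p1"
    and "poly ((pderiv ^^ 2) (p ^ 4)) t = 12 * p0 ^ 2 * p1 ^ 2 + 4 * p0 ^ 3 * p2"
    and "poly ((pderiv ^^ 3) (p ^ 4)) t = 24 * p0 * p1 ^ 3 + 36 * p0 ^ 2 * p1 * p2 + 4 * p0 ^ 3 * p3"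
    and "poly ((pderiv ^^ 4) (p ^ 4)) t = 24 * p1 ^ 4 + 144 * p0 * p1 ^ 2 * p2 + 36 * p0 ^ 2 * p2 ^ 2 + 48 * p0 ^ 2 * p1 * p3 + 4 * p0 ^ 3 * p4"
    and "poly ((pderiv ^^ 5) (p ^ 4)) t = 240 * p1 ^ 3 * p2 + 360 * p0 * p1 * p2 ^ 2 + 240 * p0 * p1 ^ 2 * p3 + 120 * p0 ^ 2 * p2 * p3 + 60 * p0 ^ 2 * p1 * p4 + 4 * p0 ^ 3 * p5"
proof -
  define q1 where "q1 = pderiv p"
  define q2 where "q2 = pderiv q1"
  define q3 where "q3 = pderiv q2"
  define q4 where "q4 = pderiv q3"
  define q5 where "q5 = pderiv q4"
  note q = q1_def[symmetric] q2_def[symmetric] q3_def[symmetric] q4_def[symmetric] q5_def[symmetric]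
  have P: "p1 = poly q1 t" "p2 = poly q2 t" "p3 = poly q3 t" "p4 = poly q4 t" "p5 = poly q5 t" 
    by (simp_all add: p1_def p2_def p3_def p4_def p5_def q5_def q4_def q3_def q2_def q1_def eval_nat_numeral)
  have 1: "pderiv (p ^ 4) = 4 * (p * p * p * q1)"
  proof -
    have "p ^ 4 = p * p * p * p" by (simp add: eval_nat_numeral)
    then show ?thesis by (simp add: pderiv_mult q algebra_simps)
  qed
  have 2: "pderiv (4 * (p * p * p * q1)) = 12 * (p * p * q1 * q1) + 4 * (p * p * p * q2)"
    by (simp add: pderiv_mult pderiv_add q algebra_simps)
  have 3: "pderiv (12 * (p * p * q1 * q1) + 4 * (p * p * p * q2)) = 24 * (p * q1 * q1 * q1) + 36 * (p * p * q1 * q2) + 4 * (p * p * p * q3)"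
    by (simp add: pderiv_mult pderiv_add q algebra_simps)
  have 4: "pderiv (24 * (p * q1 * q1 * q1) + 36 * (p * p * q1 * q2) + 4 * (p * p * p * q3))
    = 24 * (q1 * q1 * q1 * q1) + 144 * (p * q1 * q1 * q2) + 36 * (p * p * q2 * q2) + 48 * (p * p * q1 * q3) + 4 * (p * p * p * q4)"
    by (simp add: pderiv_mult pderiv_add q algebra_simps)
  have 5: "pderiv (24 * (q1 * q1 * q1 * q1) + 144 * (p * q1 * q1 * q2) + 36 * (p * p * q2 * q2) + 48 * (p * p * q1 * q3) + 4 * (p * p * p * q4))
    = 240 * (q1 * q1 * q1 * q2) + 360 * (p * q1 * q2 * q2) + 240 * (p * q1 * q1 * q3) + 120 * (p * p * q2 * q3) + 60 * (p * p * q1 * q4) + 4 * (p * p * p * q5)"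
    by (simp add: pderiv_mult pderiv_add q algebra_simps)
  have n: "(pderiv ^^ 2) r = pderiv (pderiv r)" "(pderiv ^^ 3) r = pderiv (pderiv (pderiv r))"
    "(pderiv ^^ 4) r = pderiv (pderiv (pderiv (pderiv r)))"
    "(pderiv ^^ 5) r = pderiv (pderiv (pderiv (pderiv (pderiv r))))" for r :: "real poly"
    by (simp_all add: eval_nat_numeral)
  show "poly (pderiv (p ^ 4)) t = 4 * p0 ^ 3 * p1"
    unfolding 1 P p0_def by (simp add: power3_eq_cube)
  show "poly ((pderiv ^^ 2) (p ^ 4)) t = 12 * p0 ^ 2 * p1 ^ 2 + 4 * p0 ^ 3 * p2"
    unfolding n 1 2 P p0_def by (simp add: eval_nat_numeral)
  show "poly ((pderiv ^^ 3) (p ^ 4)) t = 24 * p0 * p1 ^ 3 + 36 * p0 ^ 2 * p1 * p2 + 4 * p0 ^ 3 * p3"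
    unfolding n 1 2 3 P p0_def by (simp add: eval_nat_numeral)
  show "poly ((pderiv ^^ 4) (p ^ 4)) t = 24 * p1 ^ 4 + 144 * p0 * p1 ^ 2 * p2 + 36 * p0 ^ 2 * p2 ^ 2 + 48 * p0 ^ 2 * p1 * p3 + 4 * p0 ^ 3 * p4"
    unfolding n 1 2 3 4 P p0_def by (simp add: eval_nat_numeral)
  show "poly ((pderiv ^^ 5) (p ^ 4)) t = 240 * p1 ^ 3 * p2 + 360 * p0 * p1 * p2 ^ 2 + 240 * p0 * p1 ^ 2 * p3 + 120 * p0 ^ 2 * p2 * p3 + 60 * p0 ^ 2 * p1 * p4 + 4 * p0 ^ 3 * p5"
    unfolding n 1 2 3 4 5 P p0_def by (simp add: eval_nat_numeral)
qed

lemma polyfun_cder_prod: "finite I \<Longrightarrow> polyfun I (cder_prod I a b t)"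
  unfolding cder_prod_def[abs_def] by (intro polyfun_sum polyfun_mult polyfun_cder) auto

lemma cder_prod_eqs:
  fixes l t
  assumes I: "finite I"
  defines "p \<equiv> \<lambda>k. cder I k t l" and "B \<equiv> \<lambda>a b. cder_prod I a b t l"
  shows "B 0 0 = p 1 ^ 2 - p 0 * p 2"
    and "B 0 1 = (p 1 * p 2 - p 0 * p 3) / 2"
    and "B 0 2 = (p 1 * p 3 - p 0 * p 4) / 3"
    and "B 0 3 = (p 1 * p 4 - p 0 * p 5) / 4"
    and "B 1 0 = (p 1 * p 2 - p 0 * p 3) / 2"
    and "B 1 1 = ((p 1 * p 3 - p 0 * p 4) / 3 + p 2 ^ 2 - p 1 * p 3) / 2"
    and "B 1 2 = ((p 1 * p 4 - p 0 * p 5) / 4 + p 2 * p 3 - p 1 * p 4) / 3"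
    and "B 2 0 = (p 1 * p 3 - p 0 * p 4) / 3"
    and "B 2 1 = ((p 1 * p 4 - p 0 * p 5) / 4 + p 2 * p 3 - p 1 * p 4) / 3"
proof -
  note r = cder_prod_rec[OF I, of _ _ t l, folded p_def B_def]
  have c: "B a b = B b a" for a b
    unfolding B_def by (rule cder_prod_commute)
  \<comment> \<open>Entries with first index 0 come straight from the recursion; those with first
    index 1 are solved from them, and symmetry gives the rest.\<close>
  show 00: "B 0 0 = p 1 ^ 2 - p 0 * p 2"
    using r[of 1 0] by (simp add: p_def B_def power2_eq_square numeral_2_eq_2)
  show 01: "B 0 1 = (p 1 * p 2 - p 0 * p 3) / 2"
    using r[of 2 0] by (simp add: p_def B_def numeral_3_eq_3 numeral_2_eq_2)
  show 02: "B 0 2 = (p 1 * p 3 - p 0 * p 4) / 3"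
    using r[of 3 0] by (simp add: p_def B_def eval_nat_numeral)
  show 03: "B 0 3 = (p 1 * p 4 - p 0 * p 5) / 4"
    using r[of 4 0] by (simp add: p_def B_def eval_nat_numeral)
  show 11: "B 1 1 = ((p 1 * p 3 - p 0 * p 4) / 3 + p 2 ^ 2 - p 1 * p 3) / 2"
    using r[of 2 1] 02 by (simp add: p_def B_def eval_nat_numeral field_simps)
  show 12: "B 1 2 = ((p 1 * p 4 - p 0 * p 5) / 4 + p 2 * p 3 - p 1 * p 4) / 3"
    using r[of 3 1] 03 by (simp add: p_def B_def eval_nat_numeral field_simps)
  show "B 1 0 = (p 1 * p 2 - p 0 * p 3) / 2" "B 2 0 = (p 1 * p 3 - p 0 * p 4) / 3"
    "B 2 1 = ((p 1 * p 4 - p 0 * p 5) / 4 + p 2 * p 3 - p 1 * p 4) / 3"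
    using 01 02 12 c[of 1 0] c[of 2 0] c[of 2 1] by simp_all
qed

text \<open>The combination was found by linear algebra over the rationals, eliminating products of
  derivatives of \<open>P\<close> by decreasing total order. \<open>R a b1 b2 b3\<close> is the integrand of
  \<open>loop_equation\<close>, and \<open>n\<close> counts the zeros of \<open>P\<close>, so that \<open>N = n + 1\<close>.\<close>
lemma ode_identity:
  fixes p :: "nat \<Rightarrow> real" and B :: "nat \<Rightarrow> nat \<Rightarrow> real" and t c n :: real
  assumes B: "B 0 0 = p 1 ^ 2 - p 0 * p 2"
    "B 0 1 = (p 1 * p 2 - p 0 * p 3) / 2"
    "B 0 2 = (p 1 * p 3 - p 0 * p 4) / 3"
    "B 0 3 = (p 1 * p 4 - p 0 * p 5) / 4"
    "B 1 0 = (p 1 * p 2 - p 0 * p 3) / 2"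
    "B 1 1 = ((p 1 * p 3 - p 0 * p 4) / 3 + p 2 ^ 2 - p 1 * p 3) / 2"
    "B 1 2 = ((p 1 * p 4 - p 0 * p 5) / 4 + p 2 * p 3 - p 1 * p 4) / 3"
    "B 2 0 = (p 1 * p 3 - p 0 * p 4) / 3"
    "B 2 1 = ((p 1 * p 4 - p 0 * p 5) / 4 + p 2 * p 3 - p 1 * p 4) / 3"
  defines "R \<equiv> \<lambda>a b1 b2 b3. 2 * p (a + 2) * (p b1 * p b2 * p b3)
    - (B a b1 * p b2 * p b3 + B a b2 * p b1 * p b3 + B a b3 * p b1 * p b2)
    - 2 * c * (t * p (a + 1) + (real a - n) * p a) * (p b1 * p b2 * p b3)"
  defines "q0 \<equiv> p 0 ^ 4"
    and "q1 \<equiv> 4 * p 0 ^ 3 * p 1"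
    and "q2 \<equiv> 12 * p 0 ^ 2 * p 1 ^ 2 + 4 * p 0 ^ 3 * p 2"
    and "q3 \<equiv> 24 * p 0 * p 1 ^ 3 + 36 * p 0 ^ 2 * p 1 * p 2 + 4 * p 0 ^ 3 * p 3"
    and "q4 \<equiv> 24 * p 1 ^ 4 + 144 * p 0 * p 1 ^ 2 * p 2 + 36 * p 0 ^ 2 * p 2 ^ 2 + 48 * p 0 ^ 2 * p 1 * p 3 + 4 * p 0 ^ 3 * p 4"
    and "q5 \<equiv> 240 * p 1 ^ 3 * p 2 + 360 * p 0 * p 1 * p 2 ^ 2 + 240 * p 0 * p 1 ^ 2 * p 3 + 120 * p 0 ^ 2 * p 2 * p 3 + 60 * p 0 ^ 2 * p 1 * p 4 + 4 * p 0 ^ 3 * p 5"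
  defines "d1 \<equiv> q1 - 2 * c * t * q0"
  defines "d2 \<equiv> q2 - 4 * c * t * q1 + (4 * c^2 * t^2 - 2 * c) * q0"
  defines "d3 \<equiv> q3 - 6 * c * t * q2 + (12 * c^2 * t^2 - 6 * c) * q1 + (12 * c^2 * t - 8 * c^3 * t^3) * q0"
  defines "d5 \<equiv> q5 - 10 * c * t * q4 + (40 * c^2 * t^2 - 20 * c) * q3 + (120 * c^2 * t - 80 * c^3 * t^3) * q2 + (60 * c^2 - 240 * c^3 * t^2 + 80 * c^4 * t^4) * q1 + (160 * c^4 * t^3 - 120 * c^3 * t - 32 * c^5 * t^5) * q0"
  shows "- 1/4 * d5 + (- 5 * c * (n + 1 + 1/4) + 5/4 * c^2 * t^2) * d3 - 3/2 * c^2 * t * d2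
    + ((- 16 * (n + 1)^2 - 8 * (n + 1) + 1/2) * c^2 + (8 * (n + 1) + 2) * c^3 * t^2 - c^4 * t^4) * d1
    + (- (4 * (n + 1) + 1) * c^3 * t + c^4 * t^3) * q0
  = R 0 3 0 0
    - 24 * R 0 2 1 0
    + 39 * R 1 1 1 0
    - 129 * R 0 1 1 1
    - 9 * R 1 2 0 0
    - 6 * R 2 1 0 0
    + 15 * t * c * R 0 2 0 0
    + 198 * t * c * R 0 1 1 0
    - 24 * t * c * R 1 1 0 0
    + 3 * t * c * R 2 0 0 0
    + (- 24 * c - 30 * c * n - 93 * t ^ 2 * c ^ 2) * R 0 1 0 0
    + (2 * c - 2 * c * n + 5 * t ^ 2 * c ^ 2) * R 1 0 0 0
    + (8 * t * c ^ 2 + 16 * t * c ^ 2 * n + 12 * t ^ 3 * c ^ 3) * R 0 0 0 0"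
proof -
  have p: "p (Suc (Suc 0)) = p 2" "p (Suc (Suc (Suc 0))) = p 3"
    by (simp_all add: eval_nat_numeral)
  show ?thesis
    unfolding d1_def d2_def d3_def d5_def
    unfolding q0_def q1_def q2_def q3_def q4_def q5_def R_def
    by (simp add: p B[unfolded One_nat_def] field_simps power_numeral_reduce)
qed

context gaussian_rate
begin

lemma vmean_add:
  assumes "finite I" "polyfun I f" "polyfun I g"
  shows "vmean I (\<lambda>l. f l + g l) = vmean I f + vmean I g"
  unfolding vmean_def distrib_left
  by (intro gmean_add polyfun_mult polyfun_vdm4 assms)

lemma vmean_cmult: "vmean I (\<lambda>l. a * f l) = a * vmean I f"
  unfolding vmean_def gmean_cmult[symmetric] by (simp add: mult_ac)

lemma vmean_sum:
  assumes "finite I" "\<And>j. j \<in> J \<Longrightarrow> polyfun I (f j)"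
  shows "vmean I (\<lambda>l. \<Sum>j\<in>J. f j l) = (\<Sum>j\<in>J. vmean I (f j))"
  unfolding vmean_def sum_distrib_left
  by (intro gmean_sum polyfun_mult polyfun_vdm4 assms)

definition loop_expr where
  "loop_expr I a b1 b2 b3 t l = 2 * cder I (a + 2) t l * (cder I b1 t l * cder I b2 t l * cder I b3 t l)
    - (cder_prod I a b1 t l * cder I b2 t l * cder I b3 t l
      + cder_prod I a b2 t l * cder I b1 t l * cder I b3 t l
      + cder_prod I a b3 t l * cder I b1 t l * cder I b2 t l)
    - 2 * c * (t * cder I (a + 1) t l + (real a - real (card I)) * cder I a t l) * (cder I b1 t l * cder I b2 t l * cder I b3 t l)"

text \<open>Polynomiality is carried along because additivity of \<open>vmean\<close> rests on
  integrability.\<close>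

definition vnull :: "nat set \<Rightarrow> ((nat \<Rightarrow> real) \<Rightarrow> real) \<Rightarrow> bool" where
  "vnull I f \<longleftrightarrow> polyfun I f \<and> vmean I f = 0"

lemma vnull_loop_expr: "finite I \<Longrightarrow> vnull I (loop_expr I a b1 b2 b3 t)"
  unfolding vnull_def loop_expr_def[abs_def]
  by (intro conjI loop_equation polyfun_diff polyfun_add polyfun_mult polyfun_const polyfun_cder polyfun_cder_prod) auto

lemma vnull_add: "finite I \<Longrightarrow> vnull I f \<Longrightarrow> vnull I g \<Longrightarrow> vnull I (\<lambda>l. f l + g l)"
  unfolding vnull_def by (simp add: vmean_add polyfun_add)

lemma vnull_cmult: "vnull I f \<Longrightarrow> vnull I (\<lambda>l. a * f l)"
  unfolding vnull_def by (simp add: vmean_cmult polyfun_cmult)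

text \<open>The operator of the theorem multiplied by \<open>c\<^sup>4\<close>, where \<open>c = N / g\<close>. Derivatives are taken
  of \<open>poly q t * exp (- c * t\<^sup>2)\<close>, which is what \<open>gderiv\<close> does to the factor \<open>q\<close>.\<close>
definition ode_op :: "real \<Rightarrow> real poly \<Rightarrow> real poly" where
  "ode_op N q = smult (- 1/4) ((gderiv ^^ 5) q)
    + smult (5/4 * c^2) (monom 1 2 * (gderiv ^^ 3) q) - smult (5 * c * (N + 1/4)) ((gderiv ^^ 3) q)
    - smult (3/2 * c^2) (monom 1 1 * (gderiv ^^ 2) q)
    - smult (c^4) (monom 1 4 * gderiv q) + smult ((8 * N + 2) * c^3) (monom 1 2 * gderiv q)
    + smult ((- 16 * N^2 - 8 * N + 1/2) * c^2) (gderiv q)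
    + smult (c^4) (monom 1 3 * q) - smult ((4 * N + 1) * c^3) (monom 1 1 * q)"

lemma gderiv_add: "gderiv (p + q) = gderiv p + gderiv q"
  by (simp add: gderiv_def pderiv_add algebra_simps smult_add_right)

lemma gderiv_diff: "gderiv (p - q) = gderiv p - gderiv q"
  by (simp add: gderiv_def pderiv_diff algebra_simps smult_diff_right)

lemma gderiv_smult: "gderiv (smult a p) = smult a (gderiv p)"
  by (simp add: gderiv_def pderiv_smult smult_diff_right)

text \<open>A canonical commutation relation, since \<open>gderiv\<close> differs from
  \<open>pderiv\<close> by multiplication by \<open>2 c t\<close>.\<close>

lemma pderiv_gderiv: "pderiv (gderiv q) = gderiv (pderiv q) - smult (2 * c) q"
  by (simp add: gderiv_def pderiv_diff pderiv_mult pderiv_pCons pderiv_smult algebra_simps)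

lemma pderiv_higher_gderiv:
  "pderiv ((gderiv ^^ k) q) = (gderiv ^^ k) (pderiv q) - smult (2 * c * real k) ((gderiv ^^ (k - 1)) q)"
proof (induction k)
  case (Suc k)
  have "pderiv ((gderiv ^^ Suc k) q) = gderiv (pderiv ((gderiv ^^ k) q)) - smult (2 * c) ((gderiv ^^ k) q)"
    by (simp add: pderiv_gderiv)
  also have "gderiv (pderiv ((gderiv ^^ k) q)) = gderiv ((gderiv ^^ k) (pderiv q)) - smult (2 * c * real k) (gderiv ((gderiv ^^ (k - 1)) q))"
    unfolding Suc by (simp add: gderiv_smult gderiv_diff)
  also have "smult (2 * c * real k) (gderiv ((gderiv ^^ (k - 1)) q)) = smult (2 * c * real k) ((gderiv ^^ k) q)"
    by (cases k) auto
  finally show ?case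
    by (simp add: smult_add_left[symmetric] algebra_simps)
qed simp

text \<open>Trades one \<open>gderiv\<close> for a \<open>pderiv\<close> of the argument. Repeated
  use expresses the value of an iterated \<open>gderiv\<close> through values of ordinary
  derivatives at the same point.\<close>

lemma poly_higher_gderiv_Suc:
  "poly ((gderiv ^^ Suc k) q) t = poly ((gderiv ^^ k) (pderiv q)) t
     - 2 * c * real k * poly ((gderiv ^^ (k - 1)) q) t - 2 * c * t * poly ((gderiv ^^ k) q) t"
proof -
  have "(gderiv ^^ Suc k) q = pderiv ((gderiv ^^ k) q) - [:0, 2 * c:] * (gderiv ^^ k) q"
    by (simp add: gderiv_def)
  then have "poly ((gderiv ^^ Suc k) q) t = poly (pderiv ((gderiv ^^ k) q)) t - 2 * c * t * poly ((gderiv ^^ k) q) t"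
    by simp
  then show ?thesis
    unfolding pderiv_higher_gderiv by simp
qed

text \<open>An identity for fixed \<open>l\<close> and \<open>t\<close>, before any averaging. The
  coefficients depend on \<open>t\<close>, \<open>c\<close> and \<open>n\<close> but not on
  \<open>l\<close>, so each term on the right averages to 0.\<close>

lemma ode_op_power4:
  assumes I: "finite I" and n: "n = real (card I)"
  shows "poly (ode_op (n + 1) (charp I l ^ 4)) t =
    loop_expr I 0 3 0 0 t l
    - 24 * loop_expr I 0 2 1 0 t l
    + 39 * loop_expr I 1 1 1 0 t l
    - 129 * loop_expr I 0 1 1 1 t l
    - 9 * loop_expr I 1 2 0 0 t l
    - 6 * loop_expr I 2 1 0 0 t l
    + 15 * t * c * loop_expr I 0 2 0 0 t l
    + 198 * t * c * loop_expr I 0 1 1 0 t l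
    - 24 * t * c * loop_expr I 1 1 0 0 t l
    + 3 * t * c * loop_expr I 2 0 0 0 t l
    + (- 24 * c - 30 * c * n - 93 * t ^ 2 * c ^ 2) * loop_expr I 0 1 0 0 t l
    + (2 * c - 2 * c * n + 5 * t ^ 2 * c ^ 2) * loop_expr I 1 0 0 0 t l
    + (8 * t * c ^ 2 + 16 * t * c ^ 2 * n + 12 * t ^ 3 * c ^ 3) * loop_expr I 0 0 0 0 t l"
proof -
  define q where "q = charp I l ^ 4"
  define q0 q1 q2 q3 q4 q5 where "q0 = poly q t" and "q1 = poly (pderiv q) t" and "q2 = poly ((pderiv ^^ 2) q) t"
    and "q3 = poly ((pderiv ^^ 3) q) t" and "q4 = poly ((pderiv ^^ 4) q) t" and "q5 = poly ((pderiv ^^ 5) q) t"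
  define p where "p k = cder I k t l" for k
  define B where "B a b = cder_prod I a b t l" for a b
  define d1 d2 d3 d5 where "d1 = poly (gderiv q) t" and "d2 = poly ((gderiv ^^ 2) q) t" and "d3 = poly ((gderiv ^^ 3) q) t" and "d5 = poly ((gderiv ^^ 5) q) t"
  note S = poly_higher_gderiv_Suc[of 0] poly_higher_gderiv_Suc[of 1] poly_higher_gderiv_Suc[of 2]
    poly_higher_gderiv_Suc[of 3] poly_higher_gderiv_Suc[of 4]
  have D: "poly (gderiv r) t = poly (pderiv r) t - 2 * c * t * poly r t"
    "poly ((gderiv ^^ 2) r) t = poly (gderiv (pderiv r)) t - 2 * c * poly r t - 2 * c * t * poly (gderiv r) t"
    "poly ((gderiv ^^ 3) r) t = poly ((gderiv ^^ 2) (pderiv r)) t - 4 * c * poly (gderiv r) t - 2 * c * t * poly ((gderiv ^^ 2) r) t"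
    "poly ((gderiv ^^ 4) r) t = poly ((gderiv ^^ 3) (pderiv r)) t - 6 * c * poly ((gderiv ^^ 2) r) t - 2 * c * t * poly ((gderiv ^^ 3) r) t"
    "poly ((gderiv ^^ 5) r) t = poly ((gderiv ^^ 4) (pderiv r)) t - 8 * c * poly ((gderiv ^^ 3) r) t - 2 * c * t * poly ((gderiv ^^ 4) r) t" for r
    using S[of r t] by (simp_all add: eval_nat_numeral)
  have Q: "pderiv (pderiv q) = (pderiv ^^ 2) q" "pderiv ((pderiv ^^ 2) q) = (pderiv ^^ 3) q"
    "pderiv ((pderiv ^^ 3) q) = (pderiv ^^ 4) q" "pderiv ((pderiv ^^ 4) q) = (pderiv ^^ 5) q"
    by (simp_all add: eval_nat_numeral)
  \<comment> \<open>Expansions of the powers of \<open>d/dt - 2 c t\<close>. The equation has no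
    fourth order term; order 4 is only a stage on the way to order 5.\<close>
  have d: "d1 = q1 - 2 * c * t * q0"
    "d2 = q2 - 4 * c * t * q1 + (4 * c^2 * t^2 - 2 * c) * q0"
    "d3 = q3 - 6 * c * t * q2 + (12 * c^2 * t^2 - 6 * c) * q1 + (12 * c^2 * t - 8 * c^3 * t^3) * q0"
    "d5 = q5 - 10 * c * t * q4 + (40 * c^2 * t^2 - 20 * c) * q3 + (120 * c^2 * t - 80 * c^3 * t^3) * q2
      + (60 * c^2 - 240 * c^3 * t^2 + 80 * c^4 * t^4) * q1 + (160 * c^4 * t^3 - 120 * c^3 * t - 32 * c^5 * t^5) * q0"
    unfolding d1_def d2_def d3_def d5_def q0_def q1_def q2_def q3_def q4_def q5_def
    by (simp_all only: D Q) (simp_all add: algebra_simps power_numeral_reduce)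
  have q: "q0 = p 0 ^ 4"
    "q1 = 4 * p 0 ^ 3 * p 1"
    "q2 = 12 * p 0 ^ 2 * p 1 ^ 2 + 4 * p 0 ^ 3 * p 2"
    "q3 = 24 * p 0 * p 1 ^ 3 + 36 * p 0 ^ 2 * p 1 * p 2 + 4 * p 0 ^ 3 * p 3"
    "q4 = 24 * p 1 ^ 4 + 144 * p 0 * p 1 ^ 2 * p 2 + 36 * p 0 ^ 2 * p 2 ^ 2 + 48 * p 0 ^ 2 * p 1 * p 3 + 4 * p 0 ^ 3 * p 4"
    "q5 = 240 * p 1 ^ 3 * p 2 + 360 * p 0 * p 1 * p 2 ^ 2 + 240 * p 0 * p 1 ^ 2 * p 3 + 120 * p 0 ^ 2 * p 2 * p 3 + 60 * p 0 ^ 2 * p 1 * p 4 + 4 * p 0 ^ 3 * p 5"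
    unfolding q0_def q1_def q2_def q3_def q4_def q5_def q_def p_def cder_def poly_higher_pderiv_power4
    by (simp_all add: poly_power)
  have "poly (ode_op (n + 1) q) t = - 1/4 * d5
    + (- 5 * c * (n + 1 + 1/4) + 5/4 * c^2 * t^2) * d3
    - 3/2 * c^2 * t * d2
    + ((- 16 * (n + 1)^2 - 8 * (n + 1) + 1/2) * c^2 + (8 * (n + 1) + 2) * c^3 * t^2 - c^4 * t^4) * d1
    + (- (4 * (n + 1) + 1) * c^3 * t + c^4 * t^3) * q0"
    unfolding ode_op_def d1_def d2_def d3_def d5_def q0_def
    by (simp add: poly_monom algebra_simps)
  note ode = this
  show ?thesis
    unfolding q_def[symmetric] ode d q loop_expr_def n[symmetric] p_def[symmetric] B_def[symmetric]
    by (rule ode_identity) (simp_all only: p_def B_def cder_prod_eqs[OF I])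
qed

end


section \<open>Averages of polynomial-valued functions and the one-point density\<close>

lemma polyfun_poly_diff:
  assumes "polyfun_poly I R" "polyfun_poly I S"
  shows "polyfun_poly I (\<lambda>l. R l - S l)"
proof -
  obtain d e where "\<And>l. degree (R l) \<le> d" "\<And>l. degree (S l) \<le> e"
    using assms unfolding polyfun_poly_def by blast
  then have "degree (R l - S l) \<le> max d e" for l
    by (meson degree_diff_le max.coboundedI1 max.coboundedI2)
  then show ?thesis
    using assms unfolding polyfun_poly_def coeff_diff
    by (auto intro: polyfun_diff)
qed

lemma polyfun_poly_add:
  "polyfun_poly I R \<Longrightarrow> polyfun_poly I S \<Longrightarrow> polyfun_poly I (\<lambda>l. R l + S l)"
  using polyfun_poly_diff[of I R "\<lambda>l. [:-1:] * S l"] polyfun_poly_mult[OF polyfun_poly_const, of I S "[:-1:]"] by simp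

lemma polyfun_poly_smult: "polyfun_poly I R \<Longrightarrow> polyfun_poly I (\<lambda>l. smult a (R l))"
  using polyfun_poly_mult[OF polyfun_poly_const, of I R "[:a:]"] by simp

context gaussian_rate
begin

text \<open>Averaging coefficients instead of values keeps the result a polynomial, to which
  \<open>gderiv\<close> and \<open>ode_op\<close> apply. The degree bound in
  \<open>polyfun_poly\<close> makes \<open>Abs_poly\<close> meaningful.\<close>

definition vmean_poly :: "nat set \<Rightarrow> ((nat \<Rightarrow> real) \<Rightarrow> real poly) \<Rightarrow> real poly" where
  "vmean_poly I R = Abs_poly (\<lambda>m. vmean I (\<lambda>l. coeff (R l) m))"

lemma coeff_vmean_poly:
  assumes "polyfun_poly I R"
  shows "coeff (vmean_poly I R) m = vmean I (\<lambda>l. coeff (R l) m)"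
proof -
  obtain d where "\<And>l. degree (R l) \<le> d"
    using assms unfolding polyfun_poly_def by blast
  then have "coeff (R l) i = 0" if "i > d" for i l
    using that by (meson coeff_eq_0 order_le_less_trans)
  then have "vmean I (\<lambda>l. coeff (R l) i) = 0" if "i > d" for i
    using that by (simp add: vmean_def gmean_def)
  then show ?thesis
    unfolding vmean_poly_def by (subst coeff_Abs_poly) auto
qed

lemma polyfun_coeff: "polyfun_poly I R \<Longrightarrow> polyfun I (\<lambda>l. coeff (R l) m)"
  by (simp add: polyfun_poly_def)

lemma poly_vmean_poly:
  assumes I: "finite I" and R: "polyfun_poly I R" and d: "\<And>l. degree (R l) \<le> d"
  shows "poly (vmean_poly I R) t = (\<Sum>m\<le>d. vmean I (\<lambda>l. coeff (R l) m) * t ^ m)"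
    and "poly (vmean_poly I R) t = vmean I (\<lambda>l. poly (R l) t)"
proof -
  have "coeff (R l) i = 0" if "i > d" for i l
    using that d by (meson coeff_eq_0 order_le_less_trans)
  then have "degree (vmean_poly I R) \<le> d"
    by (intro degree_le) (simp add: coeff_vmean_poly[OF R] vmean_def gmean_def)
  then show *: "poly (vmean_poly I R) t = (\<Sum>m\<le>d. vmean I (\<lambda>l. coeff (R l) m) * t ^ m)"
    unfolding poly_altdef coeff_vmean_poly[OF R, symmetric]
    by (intro sum.mono_neutral_left) (auto simp: coeff_eq_0)
  have "poly (R l) t = (\<Sum>m\<le>d. t ^ m * coeff (R l) m)" for l
    unfolding poly_altdef using d
    by (intro sum.mono_neutral_cong_left) (auto simp: coeff_eq_0)
  then have "vmean I (\<lambda>l. poly (R l) t) = (\<Sum>m\<le>d. vmean I (\<lambda>l. t ^ m * coeff (R l) m))"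
    by (simp, intro vmean_sum I polyfun_cmult polyfun_coeff R)
  then show "poly (vmean_poly I R) t = vmean I (\<lambda>l. poly (R l) t)"
    unfolding * vmean_cmult by (simp add: mult.commute)
qed

lemma vmean_poly_diff:
  assumes "finite I" "polyfun_poly I R" "polyfun_poly I S"
  shows "vmean_poly I (\<lambda>l. R l - S l) = vmean_poly I R - vmean_poly I S"
proof (rule poly_eqI)
  fix m
  have "vmean I (\<lambda>l. coeff (R l) m + -1 * coeff (S l) m) = vmean I (\<lambda>l. coeff (R l) m) + -1 * vmean I (\<lambda>l. coeff (S l) m)"
    unfolding vmean_cmult[symmetric] by (intro vmean_add polyfun_cmult polyfun_coeff assms)
  then show "coeff (vmean_poly I (\<lambda>l. R l - S l)) m = coeff (vmean_poly I R - vmean_poly I S) m"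
    by (simp add: coeff_vmean_poly assms polyfun_poly_diff)
qed

lemma vmean_poly_add:
  assumes "finite I" "polyfun_poly I R" "polyfun_poly I S"
  shows "vmean_poly I (\<lambda>l. R l + S l) = vmean_poly I R + vmean_poly I S"
  by (rule poly_eqI) (simp add: coeff_vmean_poly assms polyfun_poly_add vmean_add polyfun_coeff)

lemma vmean_poly_smult:
  assumes "polyfun_poly I R"
  shows "vmean_poly I (\<lambda>l. smult a (R l)) = smult a (vmean_poly I R)"
  by (rule poly_eqI) (simp add: coeff_vmean_poly assms polyfun_poly_smult vmean_cmult)

lemma vmean_poly_mult:
  assumes "finite I" "polyfun_poly I R"
  shows "vmean_poly I (\<lambda>l. q * R l) = q * vmean_poly I R"
proof (rule poly_eqI)
  fix m
  have "vmean I (\<lambda>l. \<Sum>i\<le>m. coeff q i * coeff (R l) (m - i)) = (\<Sum>i\<le>m. coeff q i * vmean I (\<lambda>l. coeff (R l) (m - i)))"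
    unfolding vmean_cmult[symmetric] by (intro vmean_sum polyfun_cmult polyfun_coeff assms)
  then show "coeff (vmean_poly I (\<lambda>l. q * R l)) m = coeff (q * vmean_poly I R) m"
    by (simp add: coeff_vmean_poly assms polyfun_poly_mult polyfun_poly_const coeff_mult)
qed

lemma vmean_poly_gderiv:
  assumes "finite I" "polyfun_poly I R"
  shows "vmean_poly I (\<lambda>l. gderiv (R l)) = gderiv (vmean_poly I R)"
proof -
  have "vmean_poly I (\<lambda>l. pderiv (R l)) = pderiv (vmean_poly I R)"
    by (rule poly_eqI) (simp add: coeff_vmean_poly assms polyfun_poly_pderiv coeff_pderiv vmean_cmult)
  then show ?thesis
    unfolding gderiv_def using assms
    by (simp add: vmean_poly_diff vmean_poly_mult polyfun_poly_pderiv polyfun_poly_mult polyfun_poly_const del: mult_pCons_left)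
qed

lemma polyfun_poly_gderiv: "polyfun_poly I R \<Longrightarrow> polyfun_poly I (\<lambda>l. gderiv (R l))"
  unfolding gderiv_def
  by (intro polyfun_poly_diff polyfun_poly_pderiv polyfun_poly_mult polyfun_poly_const)

lemma polyfun_poly_higher_gderiv: "polyfun_poly I R \<Longrightarrow> polyfun_poly I (\<lambda>l. (gderiv ^^ k) (R l))"
  by (induction k) (simp_all add: polyfun_poly_gderiv)

lemma vmean_poly_higher_gderiv:
  assumes "finite I" "polyfun_poly I R"
  shows "vmean_poly I (\<lambda>l. (gderiv ^^ k) (R l)) = (gderiv ^^ k) (vmean_poly I R)"
  using assms by (induction k) (simp_all add: vmean_poly_gderiv polyfun_poly_higher_gderiv)

lemmas polyfun_poly_intros = polyfun_poly_diff polyfun_poly_add polyfun_poly_smult polyfun_poly_mult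
  polyfun_poly_const polyfun_poly_gderiv polyfun_poly_higher_gderiv

lemma polyfun_poly_ode_op: "polyfun_poly I R \<Longrightarrow> polyfun_poly I (\<lambda>l. ode_op N (R l))"
  unfolding ode_op_def by (intro polyfun_poly_intros)

text \<open>The operator acts linearly, with coefficients free of \<open>l\<close>, so it commutes
  with the coefficientwise average; this takes the place of differentiating under the multiple
  integral.\<close>

lemma vmean_poly_ode_op:
  assumes I: "finite I" and R: "polyfun_poly I R"
  shows "vmean_poly I (\<lambda>l. ode_op N (R l)) = ode_op N (vmean_poly I R)"
proof -
  note p = polyfun_poly_intros R
  note v = vmean_poly_diff[OF I] vmean_poly_add[OF I] vmean_poly_smult vmean_poly_mult[OF I] vmean_poly_gderiv[OF I] vmean_poly_higher_gderiv[OF I]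
  show ?thesis
    unfolding ode_op_def by (simp only: v p)
qed

text \<open>The density of one eigenvalue, up to the factor \<open>exp (- c t\<^sup>2)\<close> and normalisation; \<open>I\<close> indexes
  the other eigenvalues.\<close>
definition marginal :: "nat set \<Rightarrow> real poly" where
  "marginal I = vmean_poly I (\<lambda>l. charp I l ^ 4)"

lemma vnull_diff: "finite I \<Longrightarrow> vnull I f \<Longrightarrow> vnull I g \<Longrightarrow> vnull I (\<lambda>l. f l - g l)"
  using vnull_add[of I f "\<lambda>l. -1 * g l"] vnull_cmult[of I g "-1"] by simp

text \<open>The integrated-over eigenvalues are indexed by \<open>I\<close>; the singled-out one
  accounts for the \<open>+ 1\<close>.\<close>

lemma ode_op_marginal:
  assumes I: "finite I"
  shows "ode_op (real (card I) + 1) (marginal I) = 0"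
proof -
  have R: "polyfun_poly I (\<lambda>l. charp I l ^ 4)"
    using I by (intro polyfun_poly_power polyfun_poly_charp) auto
  note R' = polyfun_poly_ode_op[OF R, of "real (card I) + 1"]
  obtain d where d: "\<And>l. degree (ode_op (real (card I) + 1) (charp I l ^ 4)) \<le> d"
    using R' unfolding polyfun_poly_def by blast
  have "poly (vmean_poly I (\<lambda>l. ode_op (real (card I) + 1) (charp I l ^ 4))) t = 0" for t
  proof -
    have "vnull I (\<lambda>l. poly (ode_op (real (card I) + 1) (charp I l ^ 4)) t)"
      unfolding ode_op_power4[OF I refl]
      by (intro vnull_diff vnull_add vnull_cmult vnull_loop_expr I)
    then show ?thesis
      unfolding poly_vmean_poly(2)[OF I R' d] by (simp add: vnull_def)
  qed
  then have "vmean_poly I (\<lambda>l. ode_op (real (card I) + 1) (charp I l ^ 4)) = 0"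
    by (simp add: poly_all_0_iff_0[symmetric])
  then show ?thesis
    unfolding vmean_poly_ode_op[OF I R] marginal_def .
qed

text \<open>Fubini with coordinate \<open>j\<close> innermost: by \<open>vdm4_remove\<close> the
  Vandermonde weight is a polynomial in \<open>l j\<close> with coefficients in the other
  coordinates, so the integral splits into finitely many products. The function
  \<open>\<phi>\<close> will be a Stieltjes kernel or a power.\<close>

lemma integral_marginal:
  fixes \<phi> :: "real \<Rightarrow> complex"
  assumes I: "finite I" "j \<in> I"
    and int1: "\<And>q. integrable lborel (\<lambda>t. \<phi> t * of_real (poly q t * exp (- c * t\<^sup>2)))"
    and int2: "integrable (PiM I (\<lambda>_. lborel)) (\<lambda>l. \<phi> (l j) * of_real (vdm4 I l * gauss I l))"
  shows "(\<integral>l. \<phi> (l j) * of_real (vdm4 I l * gauss I l) \<partial>PiM I (\<lambda>_. lborel))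
    = (\<integral>t. \<phi> t * of_real (poly (marginal (I - {j})) t * exp (- c * t\<^sup>2)) \<partial>lborel)"
proof -
  interpret product_sigma_finite "\<lambda>_::nat. lborel :: real measure" by (rule product_lborel)
  define J where "J = I - {j}"
  have J: "finite J" "j \<notin> J" "I = insert j J" using I by (auto simp: J_def)
  define A where "A m = (\<integral>t. \<phi> t * of_real (poly (monom 1 m) t * exp (- c * t\<^sup>2)) \<partial>lborel)" for m
  have R: "polyfun_poly J (\<lambda>l. charp J l ^ 4)"
    using J by (intro polyfun_poly_power polyfun_poly_charp) auto
  obtain d where d: "\<And>l. degree (charp J l ^ 4) \<le> d"
    using R unfolding polyfun_poly_def by blast
  define v where "v m l = vdm4 J l * coeff (charp J l ^ 4) m * gauss J l" for m l
  have intv: "integrable (PiM J (\<lambda>_. lborel)) (v m)" for m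
    unfolding v_def[abs_def] by (intro integrable_polyfun J polyfun_mult polyfun_vdm4 polyfun_coeff[OF R])
  have vv: "(\<integral>l. v m l \<partial>PiM J (\<lambda>_. lborel)) = vmean J (\<lambda>l. coeff (charp J l ^ 4) m)" for m
    unfolding v_def vmean_def gmean_def ..
  have "(\<integral>l. \<phi> (l j) * of_real (vdm4 I l * gauss I l) \<partial>PiM I (\<lambda>_. lborel)) =
    (\<integral>x. (\<integral>y. \<phi> y * of_real (vdm4 I (x(j := y)) * gauss I (x(j := y))) \<partial>lborel) \<partial>PiM J (\<lambda>_. lborel))"
    using product_integral_insert[OF J(1,2) int2[unfolded J(3)]] by (simp add: J(3))
  also have "\<dots> = (\<integral>x. (\<Sum>m\<le>d. A m * of_real (v m x)) \<partial>PiM J (\<lambda>_. lborel))"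
  proof (rule Bochner_Integration.integral_cong[OF refl])
    fix x
    have e: "\<phi> y * of_real (vdm4 I (x(j := y)) * gauss I (x(j := y))) =
      (\<Sum>m\<le>d. (\<phi> y * of_real (poly (monom 1 m) y * exp (- c * y\<^sup>2))) * of_real (v m x))" for y
    proof -
      have 1: "vdm4 I (x(j := y)) = vdm4 J x * poly (charp J x ^ 4) y"
        using vdm4_remove[OF I, of "x(j := y)"] J
        by (simp add: J_def[symmetric] vdm4_upd charp_upd cder_def)
      have 2: "poly (charp J x ^ 4) y = (\<Sum>m\<le>d. coeff (charp J x ^ 4) m * y ^ m)"
        unfolding poly_altdef using d[of x] by (intro sum.mono_neutral_cong_left) (auto simp: coeff_eq_0)
      have "gauss J (x(j := y)) = gauss J x"
        unfolding gauss_def using J by (intro prod.cong) auto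
      then have 3: "gauss I (x(j := y)) = exp (- c * y\<^sup>2) * gauss J x"
        unfolding J(3) using J by (simp add: gauss_def)
      have "vdm4 I (x(j := y)) * gauss I (x(j := y)) = (\<Sum>m\<le>d. (poly (monom 1 m) y * exp (- c * y\<^sup>2)) * v m x)"
        unfolding 1 2 3 v_def by (simp add: sum_distrib_left sum_distrib_right poly_monom mult_ac)
      then show ?thesis
        by (simp add: sum_distrib_left mult_ac)
    qed
    show "(\<integral>y. \<phi> y * of_real (vdm4 I (x(j := y)) * gauss I (x(j := y))) \<partial>lborel) = (\<Sum>m\<le>d. A m * of_real (v m x))"
      unfolding e A_def
      by (subst Bochner_Integration.integral_sum) (intro integrable_mult_left int1 sum.cong refl integral_mult_left_zero)+
  qed
  also have "\<dots> = (\<Sum>m\<le>d. A m * of_real (vmean J (\<lambda>l. coeff (charp J l ^ 4) m)))"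
    unfolding vv[symmetric] integral_complex_of_real[symmetric]
    by (subst Bochner_Integration.integral_sum) (intro integrable_mult_right integrable_of_real intv sum.cong refl integral_mult_right_zero)+
  also have "\<dots> = (\<integral>t. (\<Sum>m\<le>d. (\<phi> t * of_real (poly (monom 1 m) t * exp (- c * t\<^sup>2))) * of_real (vmean J (\<lambda>l. coeff (charp J l ^ 4) m))) \<partial>lborel)"
    unfolding A_def
    by (subst Bochner_Integration.integral_sum) (intro integrable_mult_left int1 sum.cong refl integral_mult_left_zero[symmetric])+
  also have "\<dots> = (\<integral>t. \<phi> t * of_real (poly (marginal J) t * exp (- c * t\<^sup>2)) \<partial>lborel)"
    unfolding marginal_def poly_vmean_poly(1)[OF J(1) R d]
    by (simp add: sum_distrib_left sum_distrib_right poly_monom mult_ac)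
  finally show ?thesis unfolding J_def .
qed

lemma integral_marginal_stieltjes:
  assumes I: "finite I" "j \<in> I" and z: "z \<notin> \<real>"
  shows "integrable (PiM I (\<lambda>_. lborel)) (\<lambda>l. 1 / (z - of_real (l j)) * of_real (vdm4 I l * gauss I l))"
    and "(\<integral>l. 1 / (z - of_real (l j)) * of_real (vdm4 I l * gauss I l) \<partial>PiM I (\<lambda>_. lborel))
    = stieltjes (marginal (I - {j})) z"
proof -
  have iv: "integrable (PiM I (\<lambda>_. lborel)) (\<lambda>l. vdm4 I l * gauss I l)"
    by (intro integrable_polyfun polyfun_vdm4 I)
  show int: "integrable (PiM I (\<lambda>_. lborel)) (\<lambda>l. 1 / (z - of_real (l j)) * of_real (vdm4 I l * gauss I l))"
  proof (rule Bochner_Integration.integrable_bound)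
    show "integrable (PiM I (\<lambda>_. lborel)) (\<lambda>l. 1 / \<bar>Im z\<bar> * (vdm4 I l * gauss I l))"
      by (intro integrable_mult_right iv)
    have [measurable]: "(\<lambda>l. l j) \<in> borel_measurable (PiM I (\<lambda>_. lborel))"
      using measurable_component_singleton[OF I(2), of "\<lambda>_. lborel"] by simp
    have [measurable]: "(\<lambda>l. vdm4 I l * gauss I l) \<in> borel_measurable (PiM I (\<lambda>_. lborel))"
      using iv by (rule borel_measurable_integrable)
    show "(\<lambda>l. 1 / (z - of_real (l j)) * of_real (vdm4 I l * gauss I l)) \<in> borel_measurable (PiM I (\<lambda>_. lborel))"
      by measurable
    show "AE l in PiM I (\<lambda>_. lborel). norm (1 / (z - of_real (l j)) * of_real (vdm4 I l * gauss I l))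
      \<le> norm (1 / \<bar>Im z\<bar> * (vdm4 I l * gauss I l))"
    proof (rule AE_I2)
      fix l
      show "norm (1 / (z - of_real (l j)) * of_real (vdm4 I l * gauss I l)) \<le> norm (1 / \<bar>Im z\<bar> * (vdm4 I l * gauss I l))"
        unfolding norm_mult norm_of_real
        using norm_stieltjes_kernel_le[OF z, of "l j"] by (intro mult_mono) (auto simp: abs_mult)
    qed
  qed
  show "(\<integral>l. 1 / (z - of_real (l j)) * of_real (vdm4 I l * gauss I l) \<partial>PiM I (\<lambda>_. lborel))
    = stieltjes (marginal (I - {j})) z"
    unfolding stieltjes_eq by (rule integral_marginal[OF I integrable_stieltjes[OF z] int])
qed

lemma gint_marginal:
  assumes I: "finite I" "j \<in> I"
  shows "gint (monom 1 k * marginal (I - {j})) = vmean I (\<lambda>l. l j ^ k)"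
proof -
  have int: "integrable (PiM I (\<lambda>_. lborel)) (\<lambda>l. vdm4 I l * l j ^ k * gauss I l)"
    by (intro integrable_polyfun polyfun_mult polyfun_power polyfun_vdm4 polyfun_coord I)
  have "complex_of_real (vmean I (\<lambda>l. l j ^ k)) =
    (\<integral>l. of_real (l j ^ k) * of_real (vdm4 I l * gauss I l) \<partial>PiM I (\<lambda>_. lborel))"
    unfolding vmean_def gmean_def integral_complex_of_real[symmetric] by (simp add: mult_ac)
  also have "\<dots> = (\<integral>t. of_real (t ^ k) * of_real (poly (marginal (I - {j})) t * exp (- c * t\<^sup>2)) \<partial>lborel)"
  proof (rule integral_marginal[OF I])
    show "integrable lborel (\<lambda>t. complex_of_real (t ^ k) * of_real (poly q t * exp (- c * t\<^sup>2)))" for q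
      using integrable_of_real[OF integrable_poly_gauss[of "monom 1 k * q"], where 'a=complex]
      by (simp add: poly_monom mult_ac)
    show "integrable (PiM I (\<lambda>_. lborel)) (\<lambda>l. complex_of_real (l j ^ k) * of_real (vdm4 I l * gauss I l))"
      using integrable_of_real[OF int, where 'a=complex] by (simp add: mult_ac)
  qed
  also have "\<dots> = of_real (gint (monom 1 k * marginal (I - {j})))"
    unfolding gint_def integral_complex_of_real[symmetric] by (simp add: poly_monom mult_ac)
  finally show ?thesis by (simp only: of_real_eq_iff)
qed

lemma vmean_1_pos:
  assumes I: "finite I"
  shows "vmean I (\<lambda>_. 1) > 0"
proof -
  interpret product_sigma_finite "\<lambda>_::nat. lborel :: real measure" by (rule product_lborel)
  have int: "integrable (PiM I (\<lambda>_. lborel)) (\<lambda>l. vdm4 I l * gauss I l)"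
    by (intro integrable_polyfun polyfun_vdm4 I)
  have nn: "vdm4 I l * gauss I l \<ge> 0" for l
    unfolding vdm4_def gauss_def by (intro mult_nonneg_nonneg prod_nonneg) auto
  have eq: "vmean I (\<lambda>_. 1) = (\<integral>l. vdm4 I l * gauss I l \<partial>PiM I (\<lambda>_. lborel))"
    by (simp add: vmean_def gmean_def)
  \<comment> \<open>Unit intervals with gaps between them: the box has measure 1, and its points
    have distinct coordinates, so the weight does not vanish there.\<close>
  define Bx where "Bx = (\<Pi>\<^sub>E i\<in>I. {2 * real i .. 2 * real i + 1})"
  have pos: "vdm4 I l * gauss I l \<noteq> 0" if "l \<in> Bx" for l
  proof -
    have "l k - l j \<noteq> 0" if "k \<in> I" "j \<in> I" "j < k" for j k
    proof -
      have "l j \<le> 2 * real j + 1" "2 * real k \<le> l k"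
        using \<open>l \<in> Bx\<close> that by (auto simp: Bx_def PiE_iff)
      moreover have "real j + 1 \<le> real k" using that by linarith
      ultimately show ?thesis by linarith
    qed
    then show ?thesis
      using I by (auto simp: vdm4_def gauss_def)
  qed
  have "vmean I (\<lambda>_. 1) \<noteq> 0"
  proof
    assume "vmean I (\<lambda>_. 1) = 0"
    then have "AE l in PiM I (\<lambda>_. lborel). vdm4 I l * gauss I l = 0"
      unfolding eq using integral_nonneg_eq_0_iff_AE[OF int] nn by auto
    then have ae: "AE l in PiM I (\<lambda>_. lborel). l \<notin> Bx"
      using pos by (auto elim: eventually_mono)
    have sets: "Bx \<in> sets (PiM I (\<lambda>_. lborel))"
      unfolding Bx_def by (intro sets_PiM_I_finite I) auto
    have "emeasure (PiM I (\<lambda>_. lborel)) Bx = 0"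
      using AE_iff_measurable[OF sets, of "\<lambda>l. l \<notin> Bx"] ae sets.sets_into_space[OF sets] by auto
    moreover have "emeasure (PiM I (\<lambda>_. lborel)) Bx = 1"
      unfolding Bx_def by (subst emeasure_PiM) (auto simp: I)
    ultimately show False by simp
  qed
  moreover have "vmean I (\<lambda>_. 1) \<ge> 0"
    unfolding eq using nn by (intro Bochner_Integration.integral_nonneg) auto
  ultimately show ?thesis by simp
qed

text \<open>Two vector fields suffice. Translation, with all components 1, leaves the Vandermonde
  weight invariant; the Euler field with components \<open>l j\<close> multiplies it by its degree
  of homogeneity \<open>2 n (n - 1)\<close>, where \<open>n = card I\<close>.\<close>

lemma vmean_coord_sums:
  assumes I: "finite I"
  shows "vmean I (\<lambda>l. \<Sum>j\<in>I. l j) = 0"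
    and "2 * c * vmean I (\<lambda>l. \<Sum>j\<in>I. l j ^ 2) = (2 * (real (card I))\<^sup>2 - real (card I)) * vmean I (\<lambda>_. 1)"
proof -
  have pf: "polyfun I (\<lambda>l. \<Sum>j\<in>I. l j ^ k)" for k
    using I by (intro polyfun_sum polyfun_power polyfun_coord) auto
  have "vmean I (\<lambda>l. (\<Sum>j\<in>I. 0) + 0 - 2 * c * (\<Sum>j\<in>I. l j * 1)) = 0"
    by (rule vmean_by_parts[OF I, of "\<lambda>_ _. 1" "\<lambda>_ _. 0" "\<lambda>_. 0"])
       (use sum_vdm4_deriv[OF I, of "\<lambda>_. 1" _ "\<lambda>_ _. 0"] in \<open>auto intro: polyfun_const\<close>)
  then have "- 2 * c * vmean I (\<lambda>l. \<Sum>j\<in>I. l j) = 0"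
    unfolding vmean_cmult[symmetric] by simp
  then show "vmean I (\<lambda>l. \<Sum>j\<in>I. l j) = 0"
    using c_pos by simp
  define n where "n = real (card I)"
  define N2 where "N2 = 2 * (\<Sum>j\<in>I. \<Sum>i\<in>I - {j}. 1 :: real)"
  have N2: "N2 = 2 * (n * (n - 1))"
  proof -
    have "real (card (I - {j})) = n - 1" if "j \<in> I" for j
    proof -
      have "card I \<ge> 1" using that I by (metis One_nat_def Suc_leI card_gt_0_iff empty_iff)
      then show ?thesis using that I by (simp add: n_def of_nat_diff)
    qed
    then have "(\<Sum>j\<in>I. \<Sum>i\<in>I - {j}. 1 :: real) = (\<Sum>j\<in>I. n - 1)"
      by (intro sum.cong) auto
    then show ?thesis by (simp add: N2_def n_def)
  qed
  have "vmean I (\<lambda>l. (\<Sum>j\<in>I. 1) + N2 - 2 * c * (\<Sum>j\<in>I. l j * l j)) = 0"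
  proof (rule vmean_by_parts[OF I, of "\<lambda>j l. l j" "\<lambda>_ _. 1" "\<lambda>_. N2"])
    show "(\<Sum>j\<in>I. l j * vdm4_deriv I j l) = N2 * vdm4 I l" for l
      unfolding N2_def by (rule sum_vdm4_deriv[OF I]) simp
    show "((\<lambda>t. (l(j := t)) j) has_real_derivative 1) (at (l j))" for l j
      by simp
  qed (use I in \<open>auto intro: polyfun_coord\<close>)
  also have "(\<lambda>l. (\<Sum>j\<in>I. 1) + N2 - 2 * c * (\<Sum>j\<in>I. l j * l j)) = (\<lambda>l. (n + N2) * 1 + (- 2 * c) * (\<Sum>j\<in>I. l j ^ 2))"
    by (simp add: fun_eq_iff n_def power2_eq_square)
  also have "vmean I \<dots> = (n + N2) * vmean I (\<lambda>_. 1) + (- 2 * c) * vmean I (\<lambda>l. \<Sum>j\<in>I. l j ^ 2)"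
    unfolding vmean_cmult[symmetric] by (intro vmean_add I polyfun_cmult polyfun_const pf)
  finally show "2 * c * vmean I (\<lambda>l. \<Sum>j\<in>I. l j ^ 2) = (2 * (real (card I))\<^sup>2 - real (card I)) * vmean I (\<lambda>_. 1)"
    unfolding N2 n_def by (simp add: algebra_simps power2_eq_square)
qed

end

section \<open>Moments and the resolvent equation\<close>


lemma cmod_sin_Arg: "Im z = cmod z * sin (Arg z)"
  by (metis Arg_def Im_rcis mult_zero_left norm_zero rcis_cmod_Arg zero_complex.simps(2))

text \<open>On the sector the absolute value of \<open>sin (Arg z)\<close> is at least
  \<open>sin \<epsilon>\<close>; bounds in terms of the imaginary part thereby become bounds in
  terms of the modulus.\<close>

lemma nonreal_sector_Im:
  assumes "\<epsilon> > 0" "z \<in> nonreal_sector \<epsilon>"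
  shows "z \<notin> \<real>" "sin \<epsilon> > 0" "cmod z * sin \<epsilon> \<le> \<bar>Im z\<bar>" "z \<noteq> 0"
proof -
  have a: "\<epsilon> \<le> \<bar>Arg z\<bar>" "\<bar>Arg z\<bar> \<le> pi - \<epsilon>"
    using assms by (auto simp: nonreal_sector_def)
  then show s: "sin \<epsilon> > 0"
    using assms by (intro sin_gt_zero) linarith+
  have "sin \<epsilon> \<le> sin \<bar>Arg z\<bar>"
  proof (cases "\<bar>Arg z\<bar> \<le> pi / 2")
    case True
    then show ?thesis using a assms by (intro sin_monotone_2pi_le) linarith+
  next
    case False
    then have "sin \<epsilon> \<le> sin (pi - \<bar>Arg z\<bar>)"
      using a assms by (intro sin_monotone_2pi_le) linarith+
    then show ?thesis by simp
  qed
  also have "\<dots> = \<bar>sin (Arg z)\<bar>"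
  proof -
    have "sin \<bar>Arg z\<bar> \<ge> 0"
      using a assms by (intro sin_ge_zero) linarith+
    then show ?thesis by (cases "Arg z \<ge> 0") auto
  qed
  finally show "cmod z * sin \<epsilon> \<le> \<bar>Im z\<bar>"
    unfolding cmod_sin_Arg[of z] abs_mult by (simp add: mult_left_mono)
  show z: "z \<noteq> 0"
    using a assms by (auto simp: Arg_zero)
  have "0 < cmod z * sin \<epsilon>" using z s by simp
  with \<open>cmod z * sin \<epsilon> \<le> \<bar>Im z\<bar>\<close> show "z \<notin> \<real>"
    by (auto simp: complex_is_Real_iff)
qed

text \<open>Where the truncated subtraction in an index is off, the factor in front of \<open>\<mu>\<close> is \<open>0\<close>.\<close>
definition moment_rec :: "real \<Rightarrow> real \<Rightarrow> (nat \<Rightarrow> real) \<Rightarrow> bool" where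
  "moment_rec c N \<mu> \<longleftrightarrow> (\<forall>k. c^4 * (real k + 5) * \<mu> (k + 3) =
    (8 * N + 2) * c^3 * (real k + 2) * \<mu> (k + 1) + (4 * N + 1) * c^3 * \<mu> (k + 1)
    + (5/4 * (real k + 2) * (real k + 1) + 3/2 * (real k + 1) + (- 16 * N^2 - 8 * N + 1/2)) * c^2 * (real k * \<mu> (k - 1))
    - 5 * c * (N + 1/4) * (real k * real (k - 1) * real (k - 2) * \<mu> (k - 3))
    - 1/4 * (real k * real (k - 1) * real (k - 2) * real (k - 3) * real (k - 4) * \<mu> (k - 5)))"

context gaussian_rate
begin

lemma gderiv_mult: "gderiv (p * q) = pderiv p * q + p * gderiv q"
  by (simp add: gderiv_def pderiv_mult algebra_simps del: mult_pCons_left)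

lemma gint_monom_gderiv: "gint (monom 1 k * gderiv q) = - real k * gint (monom 1 (k - 1) * q)"
proof -
  have "gderiv (monom 1 k * q) = smult (real k) (monom 1 (k - 1) * q) + monom 1 k * gderiv q"
    unfolding gderiv_mult pderiv_monom by (simp add: smult_monom mult_smult_left[symmetric] del: mult_smult_left)
  then show ?thesis
    using gint_gderiv[of "monom 1 k * q"] by (simp add: gint_add gint_smult)
qed

lemma gint_monom_higher_gderiv:
  "gint (monom 1 k * (gderiv ^^ 2) q) = real k * real (k - 1) * gint (monom 1 (k - 2) * q)"
  "gint (monom 1 k * (gderiv ^^ 3) q) = - real k * real (k - 1) * real (k - 2) * gint (monom 1 (k - 3) * q)"
  "gint (monom 1 k * (gderiv ^^ 5) q) = - real k * real (k - 1) * real (k - 2) * real (k - 3) * real (k - 4) * gint (monom 1 (k - 5) * q)"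
  by (simp_all add: numeral_eq_Suc gint_monom_gderiv)

text \<open>Each \<open>gderiv\<close> moved to the monomial lowers its degree by one and changes
  the sign. The extreme indices come from the fifth derivative (\<open>k - 5\<close>) and from the
  terms with \<open>t^4\<close> and \<open>t^3\<close> (\<open>k + 3\<close>).\<close>

lemma moment_recurrence:
  assumes "ode_op N q = 0"
  shows "moment_rec c N (\<lambda>k. gint (monom 1 k * q))"
  unfolding moment_rec_def
proof
  fix k
  have mm: "monom 1 k * (monom 1 i * r) = monom 1 (k + i) * r" for i :: nat and r :: "real poly"
    by (simp add: mult.assoc[symmetric] mult_monom)
  have "gint (monom 1 k * ode_op N q) = 0"
    by (simp add: assms(1) gint_0)
  then show "c^4 * (real k + 5) * gint (monom 1 (k + 3) * q) =
    (8 * N + 2) * c^3 * (real k + 2) * gint (monom 1 (k + 1) * q) + (4 * N + 1) * c^3 * gint (monom 1 (k + 1) * q)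
    + (5/4 * (real k + 2) * (real k + 1) + 3/2 * (real k + 1) + (- 16 * N^2 - 8 * N + 1/2)) * c^2 * (real k * gint (monom 1 (k - 1) * q))
    - 5 * c * (N + 1/4) * (real k * real (k - 1) * real (k - 2) * gint (monom 1 (k - 3) * q))
    - 1/4 * (real k * real (k - 1) * real (k - 2) * real (k - 3) * real (k - 4) * gint (monom 1 (k - 5) * q))"
    unfolding ode_op_def distrib_left right_diff_distrib mult_smult_right mm
      gint_add gint_diff gint_smult gint_monom_gderiv gint_monom_higher_gderiv
    by (simp add: algebra_simps)
qed

text \<open>All indices in the recurrence have the same parity, so the odd moments form a chain of
  their own, started by the moment of index 1.\<close>

lemma odd_moments:
  assumes q: "ode_op N q = 0" and 1: "gint (monom 1 1 * q) = 0" and "odd m"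
  shows "gint (monom 1 m * q) = 0"
  using \<open>odd m\<close>
proof (induction m rule: less_induct)
  case (less m)
  show ?case
  proof (cases "m = 1")
    case False
    define k where "k = m - 3"
    have m: "m = k + 3" and k: "even k"
      using less.prems False by (auto simp: k_def elim!: oddE)
    define \<mu> where "\<mu> k = gint (monom 1 k * q)" for k
    have "\<mu> (k + 1) = 0"
      unfolding \<mu>_def using k m by (intro less.IH) auto
    moreover have "real k * \<mu> (k - 1) = 0"
      unfolding \<mu>_def using k m by (cases "k = 0") (auto intro!: less.IH)
    \<comment> \<open>For small even \<open>k\<close> the factors multiply to 0, so the truncated
      index is harmless; otherwise the index is odd and the induction hypothesis applies.\<close>
    moreover have "real k * real (k - 1) * real (k - 2) * \<mu> (k - 3) = 0"
    proof (cases "k \<le> 2")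
      case True
      then have "real k * real (k - 2) = 0" using k by (cases "k = 0") auto
      then show ?thesis by auto
    next
      case False
      then show ?thesis unfolding \<mu>_def using k m less.IH[of "k - 3"] by auto
    qed
    moreover have "real k * real (k - 1) * real (k - 2) * real (k - 3) * real (k - 4) * \<mu> (k - 5) = 0"
    proof (cases "k \<le> 4")
      case True
      then have "k = 0 \<or> k = 2 \<or> k = 4" using k by presburger
      then show ?thesis by auto
    next
      case False
      then show ?thesis unfolding \<mu>_def using k m less.IH[of "k - 5"] by auto
    qed
    ultimately have "c^4 * (real k + 5) * \<mu> (k + 3) = 0"
      using moment_recurrence[OF q, unfolded moment_rec_def, rule_format, of k, folded \<mu>_def] by (simp only: mult_zero_right)
    then show ?thesis
      using c_pos by (simp add: \<mu>_def m)
  qed (use 1 in simp)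
qed

text \<open>This is \<open>stieltjes_expansion\<close> multiplied by \<open>z^n\<close>. The
  subtracted polynomial in \<open>z\<close> is what makes the resolvent equation
  inhomogeneous.\<close>

lemma stieltjes_monom:
  assumes "z \<notin> \<real>"
  shows "stieltjes (monom 1 n * q) z = z ^ n * stieltjes q z - (\<Sum>k<n. z ^ (n - 1 - k) * of_real (gint (monom 1 k * q)))"
proof -
  have z: "z \<noteq> 0" using assms by auto
  have "z ^ n * (\<Sum>k<n. of_real (gint (monom 1 k * q)) / z ^ (k + 1)) = (\<Sum>k<n. z ^ (n - 1 - k) * of_real (gint (monom 1 k * q)))"
    unfolding sum_distrib_left
  proof (rule sum.cong[OF refl])
    fix k assume "k \<in> {..<n}"
    then have "z ^ n = z ^ (n - 1 - k) * z ^ (k + 1)"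
      unfolding power_add[symmetric] by simp
    then show "z ^ n * (of_real (gint (monom 1 k * q)) / z ^ (k + 1)) = z ^ (n - 1 - k) * of_real (gint (monom 1 k * q))"
      using z by simp
  qed
  then show ?thesis
    using z by (subst stieltjes_expansion[OF assms, of q n]) (simp add: distrib_left)
qed

lemma stieltjes_ode:
  assumes q: "ode_op N q = 0" and z: "z \<notin> \<real>"
    and \<mu>0: "gint q = N" and \<mu>1: "gint (monom 1 1 * q) = 0" and \<mu>2: "2 * c * gint (monom 1 2 * q) = 2 * N^2 - N"
  defines "h \<equiv> 1 / complex_of_real c" and "W \<equiv> \<lambda>k. (deriv ^^ k) (stieltjes q) z" and "n \<equiv> complex_of_real N"
  shows "- (1/4) * h^4 * W 5 + 5 * (1/4 * z^2 - h * (n + 1/4)) * h^2 * W 3 - 3/2 * h^2 * z * W 2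
    + (- (z^4) + (8 * n + 2) * h * z^2 + (- 16 * n^2 - 8 * n + 1/2) * h^2) * W 1
    + z * (z^2 - (4 * n + 1) * h) * W 0 = 2 * n * z^2 - (8 * n^2 + 5 * n) * h"
proof -
  define C where "C = complex_of_real c"
  have C: "C \<noteq> 0" "h = 1 / C" using c_pos by (auto simp: C_def h_def)
  note [simp] = stieltjes_add[OF z] stieltjes_diff[OF z] stieltjes_smult stieltjes_0
  have W: "W k = stieltjes ((gderiv ^^ k) q) z" for k
    unfolding W_def by (rule higher_deriv_stieltjes[OF z])
  have g: "gint ((gderiv ^^ k) q) = 0" if "k > 0" for k
    using that by (cases k) (simp_all add: gint_gderiv)
  define mu2 where "mu2 = complex_of_real (gint (monom 1 2 * q))"
  have mu2: "2 * C * mu2 = 2 * n^2 - n"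
    unfolding C_def mu2_def n_def using arg_cong[OF \<mu>2, of complex_of_real] by simp
  have m0: "gint (monom 1 0 * r) = gint r" for r by (simp add: monom_0)
  have S: "(\<Sum>k<1. f k) = f 0" "(\<Sum>k<2. f k) = f 0 + f 1" "(\<Sum>k<3. f k) = f 0 + f 1 + f 2" "(\<Sum>k<4. f k) = f 0 + f 1 + f 2 + f 3"
    for f :: "nat \<Rightarrow> complex"
    by (simp_all add: eval_nat_numeral)
  have W1: "W 1 = stieltjes (gderiv q) z" and W0: "W 0 = stieltjes q z"
    by (simp_all add: W)
  have G: "gint (monom 1 0 * gderiv q) = 0" "gint (monom 1 1 * gderiv q) = - N" "gint (monom 1 2 * gderiv q) = 0"
    "gint (monom 1 3 * gderiv q) = - 3 * gint (monom 1 2 * q)"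
    unfolding gint_monom_gderiv using \<mu>0 \<mu>1 by (simp_all add: m0)
  \<comment> \<open>A power of \<open>t\<close> below the order of the derivative integrates to 0
    against it, so the second and third order terms add nothing to the right-hand side.\<close>
  have G2: "gint (monom 1 0 * (gderiv ^^ 2) q) = 0"
    and G3: "gint (monom 1 0 * (gderiv ^^ 3) q) = 0" "gint (monom 1 1 * (gderiv ^^ 3) q) = 0"
    unfolding gint_monom_higher_gderiv by simp_all
  have s1: "stieltjes (monom 1 1 * (gderiv ^^ 2) q) z = z * W 2"
    unfolding stieltjes_monom[OF z] W S G2 by simp
  have s2: "stieltjes (monom 1 2 * (gderiv ^^ 3) q) z = z^2 * W 3"
    unfolding stieltjes_monom[OF z] W S G3 by simp
  have s3: "stieltjes (monom 1 4 * gderiv q) z = z^4 * W 1 + z^2 * n + 3 * mu2"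
    unfolding stieltjes_monom[OF z] W1 S G mu2_def n_def by simp
  have s4: "stieltjes (monom 1 2 * gderiv q) z = z^2 * W 1 + n"
    unfolding stieltjes_monom[OF z] W1 S G n_def by simp
  have s5: "stieltjes (monom 1 3 * q) z = z^3 * W 0 - z^2 * n - mu2"
    unfolding stieltjes_monom[OF z] W0 S m0 \<mu>0 \<mu>1 mu2_def n_def by simp
  have s6: "stieltjes (monom 1 1 * q) z = z * W 0 - n"
    unfolding stieltjes_monom[OF z] W0 S m0 \<mu>0 n_def by simp
  have "stieltjes (ode_op N q) z = 0"
    by (simp add: q)
  then have *: "- 1/4 * W 5 + 5/4 * C^2 * (z^2 * W 3) - 5 * C * (n + 1/4) * W 3 - 3/2 * C^2 * (z * W 2)
     - C^4 * (z^4 * W 1 + z^2 * n + 3 * mu2) + (8 * n + 2) * C^3 * (z^2 * W 1 + n)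
     + (- 16 * n^2 - 8 * n + 1/2) * C^2 * W 1 + C^4 * (z^3 * W 0 - z^2 * n - mu2) - (4 * n + 1) * C^3 * (z * W 0 - n) = 0"
    unfolding ode_op_def s1[symmetric] s2[symmetric] s3[symmetric] s4[symmetric] s5[symmetric] s6[symmetric]
    unfolding W W1 C_def n_def by simp
  have e: "h^4 * C^4 = 1" "h^4 * C^3 = h" "h^4 * C^2 = h^2" "h^4 * C = h^3"
    using C by (simp_all add: field_simps eval_nat_numeral)
  \<comment> \<open>With the second moment inserted, the constant terms add up, in units of
    \<open>h\<close>, to \<open>12 n^2 + 3 n - 2 (2 n^2 - n) = 8 n^2 + 5 n\<close>.\<close>
  have m: "h^4 * C^4 * (4 * mu2) = 2 * (2 * n^2 - n) * (h^4 * C^3)"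
    unfolding mu2[symmetric] by (simp add: eval_nat_numeral)
  have "0 = h^4 * (- 1/4 * W 5 + 5/4 * C^2 * (z^2 * W 3) - 5 * C * (n + 1/4) * W 3 - 3/2 * C^2 * (z * W 2)
     - C^4 * (z^4 * W 1 + z^2 * n + 3 * mu2) + (8 * n + 2) * C^3 * (z^2 * W 1 + n)
     + (- 16 * n^2 - 8 * n + 1/2) * C^2 * W 1 + C^4 * (z^3 * W 0 - z^2 * n - mu2) - (4 * n + 1) * C^3 * (z * W 0 - n))"
    unfolding * by simp
  also have "\<dots> = - 1/4 * h^4 * W 5 + 5/4 * (h^4 * C^2) * (z^2 * W 3) - 5 * (h^4 * C) * (n + 1/4) * W 3 - 3/2 * (h^4 * C^2) * (z * W 2)
     - h^4 * C^4 * (z^4 * W 1 + 2 * z^2 * n) - h^4 * C^4 * (4 * mu2) + (8 * n + 2) * (h^4 * C^3) * (z^2 * W 1 + n)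
     + (- 16 * n^2 - 8 * n + 1/2) * (h^4 * C^2) * W 1 + h^4 * C^4 * (z^3 * W 0) - (4 * n + 1) * (h^4 * C^3) * (z * W 0 - n)"
    by (simp add: algebra_simps)
  also have "\<dots> = - (1/4) * h^4 * W 5 + 5 * (1/4 * z^2 - h * (n + 1/4)) * h^2 * W 3 - 3/2 * h^2 * z * W 2
    + (- (z^4) + (8 * n + 2) * h * z^2 + (- 16 * n^2 - 8 * n + 1/2) * h^2) * W 1
    + z * (z^2 - (4 * n + 1) * h) * W 0 - (2 * n * z^2 - (8 * n^2 + 5 * n) * h)"
    unfolding m unfolding e by (simp add: algebra_simps power_numeral_reduce)
  finally show ?thesis by simp
qed

end


text \<open>The recurrence at \<open>k = 1\<close>, \<open>k = 3\<close> and
  \<open>k = 2 p + 5\<close>. From \<open>k = 5\<close> on no index is truncated; the two smaller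
  cases lack some of the lower terms.\<close>

lemma moment_rec_even:
  fixes c N :: real
  assumes "moment_rec c N \<mu>"
  shows "c^4 * (6 * \<mu> 4) = (28 * N + 7) * c^3 * \<mu> 2 + (- 16 * N^2 - 8 * N + 11) * c^2 * \<mu> 0"
    and "c^4 * (8 * \<mu> 6) = (44 * N + 11) * c^3 * \<mu> 4 + 3 * (- 16 * N^2 - 8 * N + 63/2) * c^2 * \<mu> 2 - 30 * c * (N + 1/4) * \<mu> 0"
    and "c^4 * (2 * real p + 10) * \<mu> (2 * p + 8) =
      ((8 * N + 2) * (2 * real p + 7) + 4 * N + 1) * c^3 * \<mu> (2 * p + 6)
      + (5/4 * (2 * real p + 7) * (2 * real p + 6) + 3/2 * (2 * real p + 6) + (- 16 * N^2 - 8 * N + 1/2)) * (2 * real p + 5) * c^2 * \<mu> (2 * p + 4)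
      - 5 * (N + 1/4) * (2 * real p + 5) * (2 * real p + 4) * (2 * real p + 3) * c * \<mu> (2 * p + 2)
      - 1/4 * (2 * real p + 5) * (2 * real p + 4) * (2 * real p + 3) * (2 * real p + 2) * (2 * real p + 1) * \<mu> (2 * p)"
proof -
  note r = assms[unfolded moment_rec_def, rule_format]
  show "c^4 * (6 * \<mu> 4) = (28 * N + 7) * c^3 * \<mu> 2 + (- 16 * N^2 - 8 * N + 11) * c^2 * \<mu> 0"
    using r[of 1] by (simp add: algebra_simps numeral_eq_Suc)
  show "c^4 * (8 * \<mu> 6) = (44 * N + 11) * c^3 * \<mu> 4 + 3 * (- 16 * N^2 - 8 * N + 63/2) * c^2 * \<mu> 2 - 30 * c * (N + 1/4) * \<mu> 0"
    using r[of 3] by (simp add: algebra_simps)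
  have n: "2 * p + 5 + 3 = 2 * p + 8" "2 * p + 5 + 1 = 2 * p + 6" "2 * p + 5 - 1 = 2 * p + 4" "2 * p + 5 - 2 = 2 * p + 3"
    "2 * p + 5 - 3 = 2 * p + 2" "2 * p + 5 - 4 = 2 * p + 1" "2 * p + 5 - 5 = 2 * p"
    by simp_all
  show "c^4 * (2 * real p + 10) * \<mu> (2 * p + 8) =
      ((8 * N + 2) * (2 * real p + 7) + 4 * N + 1) * c^3 * \<mu> (2 * p + 6)
      + (5/4 * (2 * real p + 7) * (2 * real p + 6) + 3/2 * (2 * real p + 6) + (- 16 * N^2 - 8 * N + 1/2)) * (2 * real p + 5) * c^2 * \<mu> (2 * p + 4)
      - 5 * (N + 1/4) * (2 * real p + 5) * (2 * real p + 4) * (2 * real p + 3) * c * \<mu> (2 * p + 2)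
      - 1/4 * (2 * real p + 5) * (2 * real p + 4) * (2 * real p + 3) * (2 * real p + 2) * (2 * real p + 1) * \<mu> (2 * p)"
    using r[of "2 * p + 5"] unfolding n by (simp add: field_simps)
qed

text \<open>This replaces the change of variables that relates the scaled ensemble to the unscaled one.\<close>
lemma moment_rec_scaling:
  fixes c N :: real
  assumes c: "c > 0" and \<mu>: "moment_rec c N \<mu>" and \<nu>: "moment_rec 1 N \<nu>"
    and 0: "\<mu> 0 = \<nu> 0" and 2: "c * \<mu> 2 = \<nu> 2"
  shows "c ^ p * \<mu> (2 * p) = \<nu> (2 * p)"
proof (induction p rule: less_induct)
  case (less p)
  \<comment> \<open>If \<open>\<mu> (2 * p)\<close> is counted as \<open>c\<close> to the power
    \<open>- p\<close>, all terms of the recurrence carry the same power of \<open>c\<close>.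
    Indices 4 and 6 come from the shortened recurrences, the full one starts at 8.\<close>
  have p2: "c^2 * \<mu> 4 = \<nu> 4"
  proof -
    have "c^2 * (6 * (c^2 * \<mu> 4)) = c^4 * (6 * \<mu> 4)"
      by (simp add: eval_nat_numeral)
    also have "\<dots> = c^2 * ((28 * N + 7) * (c * \<mu> 2) + (- 16 * N^2 - 8 * N + 11) * \<mu> 0)"
      unfolding moment_rec_even(1)[OF \<mu>] by (simp add: eval_nat_numeral algebra_simps)
    also have "\<dots> = c^2 * (6 * \<nu> 4)"
      using moment_rec_even(1)[OF \<nu>] unfolding 0 2 by simp
    finally show ?thesis using c by simp
  qed
  have p3: "c^3 * \<mu> 6 = \<nu> 6"
  proof -
    have "c * (8 * (c^3 * \<mu> 6)) = c^4 * (8 * \<mu> 6)"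
      by (simp add: eval_nat_numeral)
    also have "\<dots> = c * ((44 * N + 11) * (c^2 * \<mu> 4) + 3 * (- 16 * N^2 - 8 * N + 63/2) * (c * \<mu> 2) - 30 * (N + 1/4) * \<mu> 0)"
      unfolding moment_rec_even(2)[OF \<mu>] by (simp add: eval_nat_numeral algebra_simps)
    also have "\<dots> = c * (8 * \<nu> 6)"
      using moment_rec_even(2)[OF \<nu>] unfolding 0 2 p2 by simp
    finally show ?thesis using c by simp
  qed
  have "p = 0 \<or> p = 1 \<or> p = 2 \<or> p = 3 \<or> (\<exists>r. p = r + 4)"
    by presburger
  then consider "p = 0" | "p = 1" | "p = 2" | "p = 3" | r where "p = r + 4"
    by blast
  then show ?case
  proof cases
    case (5 r)
    have n: "2 * (r + 1) = 2 * r + 2" "2 * (r + 2) = 2 * r + 4" "2 * (r + 3) = 2 * r + 6" "2 * (r + 4) = 2 * r + 8" by simp_all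
    have ih: "c ^ r * \<mu> (2 * r) = \<nu> (2 * r)" "c ^ (r + 1) * \<mu> (2 * r + 2) = \<nu> (2 * r + 2)"
      "c ^ (r + 2) * \<mu> (2 * r + 4) = \<nu> (2 * r + 4)" "c ^ (r + 3) * \<mu> (2 * r + 6) = \<nu> (2 * r + 6)"
      using less.IH[of r] less.IH[of "r + 1", unfolded n] less.IH[of "r + 2", unfolded n] less.IH[of "r + 3", unfolded n] 5 by simp_all
    have "(2 * real r + 10) * (c ^ (r + 4) * \<mu> (2 * r + 8)) = c ^ r * (c^4 * (2 * real r + 10) * \<mu> (2 * r + 8))"
      by (simp add: power_add)
    also have "\<dots> = (2 * real r + 10) * \<nu> (2 * r + 8)"
      using moment_rec_even(3)[OF \<nu>, of r, folded ih]
      unfolding moment_rec_even(3)[OF \<mu>, of r] power_add by (simp add: algebra_simps)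
    finally show ?thesis
      unfolding 5 n by (simp add: add_eq_0_iff_both_eq_0 mult_left_cancel[of "2 * real r + 10"])
  qed (use 0 2 p2 p3 in simp_all)
qed

lemma moment_rec_values:
  fixes N :: real
  assumes \<nu>: "moment_rec 1 N \<nu>" and 0: "\<nu> 0 = N" and 2: "2 * \<nu> 2 = 2 * N^2 - N"
  shows "4 * \<nu> 4 = 8*N^3 - 10*N^2 + 5*N"
    and "8 * \<nu> 6 = 40*N^4 - 88*N^3 + 104*N^2 - 41*N"
    and "16 * \<nu> 8 = 224*N^5 - 744*N^4 + 1496*N^3 - 1380*N^2 + 509*N"
    and "32 * \<nu> 10 = 1344*N^6 - 6176*N^5 + 18320*N^4 - 28600*N^3 + 24286*N^2 - 8229*N"
    and "64 * \<nu> 12 = 8448*N^7 - 50752*N^6 + 204768*N^5 - 470080*N^4 + 668592*N^3 - 516958*N^2 + 166377*N"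
proof -
  have n2: "\<nu> 2 = (2 * N^2 - N) / 2" using 2 by simp
  have n4: "\<nu> 4 = (8*N^3 - 10*N^2 + 5*N) / 4"
    using moment_rec_even(1)[OF \<nu>] unfolding 0 n2 by (simp add: field_simps power_numeral_reduce)
  have n6: "\<nu> 6 = (40*N^4 - 88*N^3 + 104*N^2 - 41*N) / 8"
    using moment_rec_even(2)[OF \<nu>] unfolding 0 n2 n4 by (simp add: field_simps power_numeral_reduce)
  have i: "2 * 1 = (2::nat)" "2 * 2 = (4::nat)" "2 + 8 = (10::nat)" "2 + 6 = (8::nat)" "2 + 4 = (6::nat)" "2 + 2 = (4::nat)"
    "4 + 8 = (12::nat)" "4 + 6 = (10::nat)" "4 + 4 = (8::nat)" "4 + 2 = (6::nat)"
    by simp_all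
  note r = moment_rec_even(3)[OF \<nu>]
  have n8: "\<nu> 8 = (224*N^5 - 744*N^4 + 1496*N^3 - 1380*N^2 + 509*N) / 16"
    using r[of 0] unfolding mult_0_right add_0 n2 n4 n6 0 by (simp add: field_simps power_numeral_reduce)
  have n10: "\<nu> 10 = (1344*N^6 - 6176*N^5 + 18320*N^4 - 28600*N^3 + 24286*N^2 - 8229*N) / 32"
    using r[of 1, unfolded i] unfolding n2 n4 n6 n8 by (simp add: field_simps power_numeral_reduce)
  have n12: "\<nu> 12 = (8448*N^7 - 50752*N^6 + 204768*N^5 - 470080*N^4 + 668592*N^3 - 516958*N^2 + 166377*N) / 64"
    using r[of 2, unfolded i] unfolding n4 n6 n8 n10 by (simp add: field_simps power_numeral_reduce)
  show "4 * \<nu> 4 = 8*N^3 - 10*N^2 + 5*N"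
    "8 * \<nu> 6 = 40*N^4 - 88*N^3 + 104*N^2 - 41*N"
    "16 * \<nu> 8 = 224*N^5 - 744*N^4 + 1496*N^3 - 1380*N^2 + 509*N"
    "32 * \<nu> 10 = 1344*N^6 - 6176*N^5 + 18320*N^4 - 28600*N^3 + 24286*N^2 - 8229*N"
    "64 * \<nu> 12 = 8448*N^7 - 50752*N^6 + 204768*N^5 - 470080*N^4 + 668592*N^3 - 516958*N^2 + 166377*N"
    unfolding n4 n6 n8 n10 n12 by simp_all
qed

section \<open>The ensemble expressed through weighted polynomial averages\<close>

context gaussian_rate
begin

lemma higher_gderiv_add: "(gderiv ^^ k) (p + q) = (gderiv ^^ k) p + (gderiv ^^ k) q"
  by (induction k) (simp_all add: gderiv_add)

lemma higher_gderiv_smult: "(gderiv ^^ k) (smult a p) = smult a ((gderiv ^^ k) p)"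
  by (induction k) (simp_all add: gderiv_smult)

lemma ode_op_add: "ode_op N (p + q) = ode_op N p + ode_op N q"
  unfolding ode_op_def higher_gderiv_add gderiv_add distrib_left smult_add_right by simp

lemma ode_op_smult: "ode_op N (smult a p) = smult a (ode_op N p)"
  unfolding ode_op_def higher_gderiv_smult gderiv_smult smult_add_right smult_diff_right mult_smult_right
  by (simp add: mult.commute[of a])

lemma ode_op_0: "ode_op N 0 = 0"
  using ode_op_smult[of N 0 0] by simp

lemma ode_op_sum_eq_0:
  "(\<And>j. j \<in> J \<Longrightarrow> ode_op N (f j) = 0) \<Longrightarrow> ode_op N (\<Sum>j\<in>J. f j) = 0"
  by (induction J rule: infinite_finite_induct) (simp_all add: ode_op_add ode_op_0)

text \<open>The one-point density of total mass \<open>N\<close>, without its Gaussian factor. The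
  summand for \<open>j\<close> belongs to the \<open>j\<close>-th term of the resolvent or of a
  power sum.\<close>

definition density_poly :: "nat \<Rightarrow> real poly" where
  "density_poly N = smult (1 / gse_partition c N) (\<Sum>j<N. marginal ({..<N} - {j}))"

lemma gse_weight_eq: "gse_weight c N l = vdm4 {..<N} l * gauss {..<N} l"
proof -
  have "(\<Prod>k<N. \<Prod>j<k. \<bar>l k - l j\<bar> ^ 4) = vdm4 {..<N} l"
    unfolding vdm4_def
  proof (intro prod.cong refl)
    fix k assume "k \<in> {..<N}"
    then show "{..<k} = {j \<in> {..<N}. j < k}" by auto
  qed auto
  then show ?thesis
    unfolding gse_weight_def gauss_def by simp
qed

lemma gse_partition_eq: "gse_partition c N = vmean {..<N} (\<lambda>_. 1)"
  by (simp add: gse_partition_def gse_weight_eq vmean_def gmean_def)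

lemma gse_partition_pos: "gse_partition c N > 0"
  unfolding gse_partition_eq by (rule vmean_1_pos) simp

lemma integral_gse:
  fixes f :: "(nat \<Rightarrow> real) \<Rightarrow> 'a::{banach, second_countable_topology}"
  assumes "f \<in> borel_measurable (PiM {..<N} (\<lambda>_. lborel))"
  shows "(\<integral>l. f l \<partial>gse c N) =
    (\<integral>l. ((vdm4 {..<N} l * gauss {..<N} l) / gse_partition c N) *\<^sub>R f l \<partial>PiM {..<N} (\<lambda>_. lborel))"
  unfolding gse_def gse_weight_eq
proof (rule integral_density[OF assms])
  have [measurable]: "(\<lambda>l. vdm4 {..<N} l * gauss {..<N} l) \<in> borel_measurable (PiM {..<N} (\<lambda>_. lborel))"
    by (intro borel_measurable_integrable integrable_polyfun polyfun_vdm4) auto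
  show "(\<lambda>l. (vdm4 {..<N} l * gauss {..<N} l) / gse_partition c N) \<in> borel_measurable (PiM {..<N} (\<lambda>_. lborel))"
    by measurable
  have "vdm4 {..<N} l * gauss {..<N} l \<ge> 0" for l
    unfolding vdm4_def gauss_def by (intro mult_nonneg_nonneg prod_nonneg) auto
  then show "AE l in PiM {..<N} (\<lambda>_. lborel). 0 \<le> (vdm4 {..<N} l * gauss {..<N} l) / gse_partition c N"
    using gse_partition_pos[of N] by (intro AE_I2) simp
qed

lemma measurable_coord: "j < N \<Longrightarrow> (\<lambda>l. l j) \<in> borel_measurable (PiM {..<N} (\<lambda>_. lborel :: real measure))"
  using measurable_component_singleton[of j "{..<N}" "\<lambda>_. lborel :: real measure"] by simp

lemma gse_stieltjes:
  assumes z: "z \<notin> \<real>"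
  shows "(\<integral>l. (\<Sum>j<N. 1 / (z - complex_of_real (l j))) \<partial>gse c N) = stieltjes (density_poly N) z"
proof -
  define Z where "Z = gse_partition c N"
  have m: "(\<lambda>l. \<Sum>j<N. 1 / (z - complex_of_real (l j))) \<in> borel_measurable (PiM {..<N} (\<lambda>_. lborel))"
    by (intro borel_measurable_sum borel_measurable_divide borel_measurable_diff borel_measurable_const
        borel_measurable_of_real measurable_coord) auto
  have sum: "stieltjes (\<Sum>j\<in>J. f j) z = (\<Sum>j\<in>J. stieltjes (f j) z)" for J :: "nat set" and f
    by (induction J rule: infinite_finite_induct) (simp_all add: stieltjes_0 stieltjes_add[OF z])
  have "(\<integral>l. (\<Sum>j<N. 1 / (z - complex_of_real (l j))) \<partial>gse c N) =
    (\<integral>l. (1 / of_real Z) * (\<Sum>j<N. 1 / (z - of_real (l j)) * of_real (vdm4 {..<N} l * gauss {..<N} l)) \<partial>PiM {..<N} (\<lambda>_. lborel))"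
    unfolding integral_gse[OF m] Z_def
    by (intro Bochner_Integration.integral_cong refl) (simp add: scaleR_conv_of_real sum_distrib_left sum_divide_distrib mult_ac)
  also have "\<dots> = (1 / of_real Z) * (\<Sum>j<N. (\<integral>l. 1 / (z - of_real (l j)) * of_real (vdm4 {..<N} l * gauss {..<N} l) \<partial>PiM {..<N} (\<lambda>_. lborel)))"
    unfolding integral_mult_right_zero
    by (subst Bochner_Integration.integral_sum) (rule integral_marginal_stieltjes(1)[OF _ _ z], simp_all)
  also have "\<dots> = (1 / of_real Z) * (\<Sum>j<N. stieltjes (marginal ({..<N} - {j})) z)"
    using integral_marginal_stieltjes(2)[OF _ _ z, of "{..<N}"] by simp
  also have "\<dots> = stieltjes (density_poly N) z"
    unfolding density_poly_def stieltjes_smult sum Z_def by simp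
  finally show ?thesis .
qed

lemma gint_density_poly:
  "gint (monom 1 k * density_poly N) = vmean {..<N} (\<lambda>l. \<Sum>j<N. l j ^ k) / gse_partition c N"
proof -
  have sum: "gint (\<Sum>j\<in>J. f j) = (\<Sum>j\<in>J. gint (f j))" for J :: "nat set" and f
    by (induction J rule: infinite_finite_induct) (simp_all add: gint_0 gint_add)
  have "vmean {..<N} (\<lambda>l. \<Sum>j<N. l j ^ k) = (\<Sum>j<N. vmean {..<N} (\<lambda>l. l j ^ k))"
    by (intro vmean_sum polyfun_power polyfun_coord) auto
  then show ?thesis
    unfolding density_poly_def mult_smult_right gint_smult sum_distrib_left sum
    by (simp add: gint_marginal sum_divide_distrib)
qed

lemma gse_power_sum: "(\<integral>l. (\<Sum>j<N. l j ^ k) \<partial>gse c N) = gint (monom 1 k * density_poly N)"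
proof -
  have m: "(\<lambda>l. \<Sum>j<N. l j ^ k) \<in> borel_measurable (PiM {..<N} (\<lambda>_. lborel :: real measure))"
    by (intro borel_measurable_sum borel_measurable_power measurable_coord) auto
  have "(\<integral>l. (\<Sum>j<N. l j ^ k) \<partial>gse c N) =
    (\<integral>l. (vdm4 {..<N} l * (\<Sum>j<N. l j ^ k) * gauss {..<N} l) / gse_partition c N \<partial>PiM {..<N} (\<lambda>_. lborel))"
    unfolding integral_gse[OF m] by (simp add: mult_ac)
  then show ?thesis
    unfolding gint_density_poly vmean_def gmean_def by simp
qed

text \<open>An equation together with its initial data. Once the resolvent and the moments are
  written through this polynomial, these four facts determine the rest.\<close>

lemma density_poly:
  assumes N: "N \<ge> 1"
  shows "ode_op (real N) (density_poly N) = 0"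
    and "gint (monom 1 0 * density_poly N) = real N"
    and "gint (monom 1 1 * density_poly N) = 0"
    and "2 * c * gint (monom 1 2 * density_poly N) = 2 * (real N)^2 - real N"
proof -
  have "ode_op (real N) (marginal ({..<N} - {j})) = 0" if "j \<in> {..<N}" for j
    using ode_op_marginal[of "{..<N} - {j}"] that N by (simp add: of_nat_diff)
  then show "ode_op (real N) (density_poly N) = 0"
    unfolding density_poly_def ode_op_smult by (subst ode_op_sum_eq_0) auto
  note s = vmean_coord_sums[of "{..<N}", unfolded card_lessThan, folded gse_partition_eq]
  show "gint (monom 1 0 * density_poly N) = real N"
    unfolding gint_density_poly using gse_partition_pos[of N] vmean_cmult[of "{..<N}" "real N" "\<lambda>_. 1", folded gse_partition_eq]
    by simp
  show "gint (monom 1 1 * density_poly N) = 0"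
    unfolding gint_density_poly using s(1) by simp
  show "2 * c * gint (monom 1 2 * density_poly N) = 2 * (real N)^2 - real N"
    unfolding gint_density_poly times_divide_eq_right using s(2) gse_partition_pos[of N] by simp
qed

text \<open>Expansion to order \<open>2 K\<close>: the odd moments drop out, and the remainder,
  bounded by a multiple of \<open>1 / \<bar>Im z\<bar>\<close>, gains the missing power of
  \<open>1 / z\<close> from the sector condition. The estimate holds on the whole sector.\<close>

lemma stieltjes_asymptotics:
  assumes \<epsilon>: "\<epsilon> > 0" and odd: "\<And>k. odd k \<Longrightarrow> gint (monom 1 k * q) = 0"
  shows "(\<lambda>z. stieltjes q z - (\<Sum>p<K. of_real (gint (monom 1 (2 * p) * q)) / z ^ (2 * p + 1)))
    \<in> O[inf at_infinity (principal (nonreal_sector \<epsilon>))](\<lambda>z. 1 / z ^ (2 * K + 1))"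
proof -
  obtain b where b: "\<And>z. z \<notin> \<real> \<Longrightarrow> norm (stieltjes (monom 1 (2 * K) * q) z) \<le> b / \<bar>Im z\<bar>"
    using stieltjes_bound by blast
  have sums: "(\<Sum>k<2 * K. of_real (gint (monom 1 k * q)) / z ^ (k + 1)) = (\<Sum>p<K. of_real (gint (monom 1 (2 * p) * q)) / z ^ (2 * p + 1))" for z :: complex
    by (induction K) (simp_all add: odd)
  show ?thesis
  proof (rule bigoI)
    show "\<forall>\<^sub>F z in inf at_infinity (principal (nonreal_sector \<epsilon>)).
      norm (stieltjes q z - (\<Sum>p<K. of_real (gint (monom 1 (2 * p) * q)) / z ^ (2 * p + 1))) \<le> (b / sin \<epsilon>) * norm (1 / z ^ (2 * K + 1))"
      unfolding eventually_inf_principal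
    proof (intro always_eventually allI impI)
      fix z assume "z \<in> nonreal_sector \<epsilon>"
      note z = nonreal_sector_Im[OF \<epsilon> this]
      have Im: "Im z \<noteq> 0" using z(1) by (simp add: not_Reals_Im)
      have "b / \<bar>Im z\<bar> \<ge> 0" using b[OF z(1)] norm_ge_zero order_trans by blast
      then have b0: "b \<ge> 0" using Im by (simp add: zero_le_divide_iff)
      have "norm (stieltjes (monom 1 (2 * K) * q) z) \<le> b / (cmod z * sin \<epsilon>)"
        using b[OF z(1)] z b0 Im by (smt (verit) frac_le mult_pos_pos zero_less_norm_iff)
      then have "norm (stieltjes (monom 1 (2 * K) * q) z / z ^ (2 * K)) \<le> b / (cmod z * sin \<epsilon>) / norm (z ^ (2 * K))"
        unfolding norm_divide by (intro divide_right_mono) auto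
      then show "norm (stieltjes q z - (\<Sum>p<K. of_real (gint (monom 1 (2 * p) * q)) / z ^ (2 * p + 1))) \<le> (b / sin \<epsilon>) * norm (1 / z ^ (2 * K + 1))"
        unfolding sums[symmetric] stieltjes_expansion[OF z(1), of q "2 * K"]
        by (simp add: norm_divide norm_mult norm_power mult_ac)
    qed
  qed
qed

end


text \<open>Serves to transfer derivatives to the resolvent, whose identification with a Stieltjes
  transform is available only off the real axis.\<close>

lemma higher_deriv_cong_on_open:
  assumes "open S" "\<And>w. w \<in> S \<Longrightarrow> f w = g w" "z \<in> S"
  shows "(deriv ^^ k) f z = (deriv ^^ k) g z"
  using assms(3)
proof (induction k arbitrary: z)
  case (Suc k)
  have "eventually (\<lambda>w. w \<in> S) (nhds z)"
    using Suc.prems assms(1) by (intro eventually_nhds_in_open)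
  then have "eventually (\<lambda>w. (deriv ^^ k) f w = (deriv ^^ k) g w) (nhds z)"
    by eventually_elim (rule Suc.IH)
  then show ?case by (simp add: deriv_cong_ev)
qed (use assms in simp)

theorem theorem15:
  fixes g :: real and N :: nat
  assumes "g > 0" and "N \<ge> 1"
  defines "W \<equiv> gse_resolvent g N"
    and "m \<equiv> gse_moment N"
    and "h \<equiv> complex_of_real (g / real N)"
    and "n \<equiv> real N"
  shows "W holomorphic_on (- \<real>)
    \<and> (\<forall>x. x \<notin> \<real> \<longrightarrow>
        - (1/4) * h^4 * (deriv ^^ 5) W x
        + 5 * (1/4 * x^2 - h * (of_nat N + 1/4)) * h^2 * (deriv ^^ 3) W x
        - 3/2 * h^2 * x * (deriv ^^ 2) W x
        + (- (x^4) + (8 * of_nat N + 2) * h * x^2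
             + (- 16 * of_nat N ^ 2 - 8 * of_nat N + 1/2) * h^2) * deriv W x
        + x * (x^2 - (4 * of_nat N + 1) * h) * W x
        = 2 * of_nat N * (x^2 - 4 * of_real g) - 5 * of_real g)
    \<and> (\<forall>\<epsilon>>0. \<forall>K.
        (\<lambda>x. W x - (\<Sum>p<K. h^p * of_real (m (2*p)) / x^(2*p+1)))
          \<in> O[inf at_infinity (principal (nonreal_sector \<epsilon>))](\<lambda>x. 1 / x^(2*K+1)))
    \<and> m 0 = n
    \<and> 2 * m 2 = 2*n^2 - n
    \<and> 4 * m 4 = 8*n^3 - 10*n^2 + 5*n
    \<and> 8 * m 6 = 40*n^4 - 88*n^3 + 104*n^2 - 41*n
    \<and> 16 * m 8 = 224*n^5 - 744*n^4 + 1496*n^3 - 1380*n^2 + 509*n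
    \<and> 32 * m 10 = 1344*n^6 - 6176*n^5 + 18320*n^4 - 28600*n^3 + 24286*n^2 - 8229*n
    \<and> 64 * m 12 = 8448*n^7 - 50752*n^6 + 204768*n^5 - 470080*n^4 + 668592*n^3
                    - 516958*n^2 + 166377*n"
proof -
  define c where "c = real N / g"
  have c: "c > 0" using assms(1,2) by (simp add: c_def)
  \<comment> \<open>\<open>G\<close> is the scaled ensemble of the resolvent and \<open>U\<close>
    the unscaled one of the moments; they are compared through their moment recurrences.\<close>
  interpret G: gaussian_rate c by standard (rule c)
  interpret U: gaussian_rate 1 by standard simp
  define Q where "Q = G.density_poly N"
  have h: "h = 1 / complex_of_real c"
    using assms(1,2) by (simp add: h_def c_def)
  have W: "W z = G.stieltjes Q z" if "z \<notin> \<real>" for z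
    using G.gse_stieltjes[OF that, of N] by (simp add: W_def gse_resolvent_def c_def[symmetric] Q_def)
  have m: "m k = U.gint (monom 1 k * U.density_poly N)" for k
    unfolding m_def gse_moment_def by (rule U.gse_power_sum)
  define \<mu> where "\<mu> k = G.gint (monom 1 k * Q)" for k
  note Q = G.density_poly[OF assms(2), folded Q_def]
  note R = U.density_poly[OF assms(2)]
  have \<mu>_rec: "moment_rec c n \<mu>"
    unfolding \<mu>_def n_def by (rule G.moment_recurrence[OF Q(1)])
  have m_rec: "moment_rec 1 n m"
    unfolding m n_def by (rule U.moment_recurrence[OF R(1)])
  have m0: "m 0 = n" and m2: "2 * m 2 = 2 * n^2 - n"
    using R(2,4) by (simp_all add: m n_def)
  have "c ^ p * \<mu> (2 * p) = m (2 * p)" for p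
    by (rule moment_rec_scaling[OF c \<mu>_rec m_rec])
       (use Q(2,4) m0 m2 in \<open>simp_all add: \<mu>_def n_def\<close>)
  then have scaled: "of_real (\<mu> (2 * p)) = h ^ p * of_real (m (2 * p))" for p
  proof -
    have "complex_of_real (m (2 * p)) = of_real c ^ p * of_real (\<mu> (2 * p))"
      using \<open>c ^ p * \<mu> (2 * p) = m (2 * p)\<close> by (simp flip: of_real_power of_real_mult)
    then show ?thesis using c by (simp add: h power_divide)
  qed
  have W_deriv: "(deriv ^^ k) W z = (deriv ^^ k) (G.stieltjes Q) z" if "z \<notin> \<real>" for k z
    using that W by (intro higher_deriv_cong_on_open[OF open_nonreal]) auto
  have "G.stieltjes Q holomorphic_on - \<real>"
    using G.has_field_derivative_stieltjes[of _ Q]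
    by (auto simp: holomorphic_on_open[OF open_nonreal])
  then have hol: "W holomorphic_on - \<real>"
    by (rule holomorphic_transform) (simp add: W)
  have ode: "- (1/4) * h^4 * (deriv ^^ 5) W x
        + 5 * (1/4 * x^2 - h * (of_nat N + 1/4)) * h^2 * (deriv ^^ 3) W x
        - 3/2 * h^2 * x * (deriv ^^ 2) W x
        + (- (x^4) + (8 * of_nat N + 2) * h * x^2
             + (- 16 * of_nat N ^ 2 - 8 * of_nat N + 1/2) * h^2) * deriv W x
        + x * (x^2 - (4 * of_nat N + 1) * h) * W x
        = 2 * of_nat N * (x^2 - 4 * of_real g) - 5 * of_real g" if x: "x \<notin> \<real>" for x
  proof -
    \<comment> \<open>With this, the term \<open>(8 n^2 + 5 n) h\<close> of
      \<open>stieltjes_ode\<close> becomes \<open>8 n g + 5 g\<close>.\<close>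
    have hg: "of_nat N * h = complex_of_real g"
      using assms(1,2) by (simp add: h_def)
    have "2 * of_nat N * x^2 - (8 * of_nat N ^ 2 + 5 * of_nat N) * h = 2 * of_nat N * x^2 - 8 * of_nat N * (of_nat N * h) - 5 * (of_nat N * h)"
      by (simp add: algebra_simps power2_eq_square)
    also have "\<dots> = 2 * of_nat N * (x^2 - 4 * of_real g) - 5 * of_real g"
      unfolding hg by (simp add: algebra_simps)
    finally show ?thesis
      using G.stieltjes_ode[OF Q(1) x _ Q(3,4)] Q(2) W_deriv[OF x, of 1] W[OF x]
      by (simp add: W_deriv[OF x] h[symmetric] monom_0)
  qed
  have asym: "(\<lambda>x. W x - (\<Sum>p<K. h^p * of_real (m (2*p)) / x^(2*p+1)))
          \<in> O[inf at_infinity (principal (nonreal_sector \<epsilon>))](\<lambda>x. 1 / x^(2*K+1))" if \<epsilon>: "\<epsilon> > 0" for \<epsilon> K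
  proof -
    have "(\<lambda>x. G.stieltjes Q x - (\<Sum>p<K. h^p * of_real (m (2*p)) / x^(2*p+1)))
          \<in> O[inf at_infinity (principal (nonreal_sector \<epsilon>))](\<lambda>x. 1 / x^(2*K+1))"
      using G.stieltjes_asymptotics[OF \<epsilon> G.odd_moments[OF Q(1,3)], of K]
      unfolding \<mu>_def[symmetric] scaled .
    moreover have "\<forall>\<^sub>F x in inf at_infinity (principal (nonreal_sector \<epsilon>)). W x = G.stieltjes Q x"
      unfolding eventually_inf_principal using nonreal_sector_Im(1)[OF \<epsilon>] W by (intro always_eventually) auto
    ultimately show ?thesis
      by (subst landau_o.big.in_cong) (auto elim: eventually_mono)
  qed
  note v = moment_rec_values[OF m_rec m0 m2]
  show ?thesis
    using hol ode asym m0 m2 v by blast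
qed

end
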